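(* Let $A:\mathcal F_\lambda\otimes\mathcal F_\gamma\otimes\mathcal F_\tau\to\mathcal F_{\lambda+\gamma+\tau+4}$ be a $\mathfrak{vect}(1)$-invariant ternary differential operator of order $4$. Then, up to permutations and dualizations, $A$ is a multiple of one of the following operators, evaluated on $\varphi(dx)^\lambda\otimes\psi(dx)^\gamma\otimes\chi(dx)^\tau$, where the $\epsilon_i$ and $s,t$ are constants: (1) for $(\gamma,\lambda)=(0,0)$: $\ \epsilon_1\{\{d\varphi,d\psi\},\chi(dx)^\tau\}+\epsilon_2\{\{\chi(dx)^\tau,d\varphi\},d\psi\}$; (2) for $(\lambda,\gamma,\tau)=(-2,0,-2)$: $\ \epsilon_1\{d\{d\psi,\varphi(dx)^{-2}\},\chi(dx)^{-2}\}+\epsilon_2\{d\{d\psi,\chi(dx)^{-2}\},\varphi(dx)^{-2}\}$; (3) for $\gamma=0$ and $\lambda,\tau\neq0$: $\ \Delta_{\lambda,1,\tau;3}(\varphi(dx)^\lambda,d\psi,\chi(dx)^\tau)$; (4) for $(\lambda,\gamma)=(-\frac23,-\frac23)$ and $\tau\neq-1$: $\ \{\mathrm{Gz}(\varphi(dx)^{-2/3},\psi(dx)^{-2/3}),\chi(dx)^\tau\}$; (5) for $(\lambda,\gamma,\tau)=(-1,-\frac23,-\frac23)$: $\ \epsilon_1\mathrm{Gz}(\{\varphi(dx)^{-1},\psi(dx)^{-2/3}\},\chi(dx)^{-2/3})+\epsilon_2\mathrm{Gz}(\{\varphi(dx)^{-1},\chi(dx)^{-2/3}\},\psi(dx)^{-2/3})$;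 (6) for $(\lambda,\gamma)=(-\frac32-\tau,\tau)$ and $\tau\notin\{-\frac32,-\frac23,0,-\frac34\}$: $\ \Xi(\varphi(dx)^\lambda,\psi(dx)^\gamma,\chi(dx)^\tau)$; (7) for $(\lambda,\gamma,\tau)=(-\frac34,-\frac34,-\frac34)$: $\ \Xi_{s,t}(\varphi(dx)^\lambda,\psi(dx)^\gamma,\chi(dx)^\tau)$.
   Context: For $\lambda\in\mathbb R$, $\mathcal F_\lambda=\{f(dx)^\lambda : f\in\mathbb R[x]\}$ is the space of weighted densities of weight $\lambda$ on $\mathbb R$. The Lie algebra $\mathfrak{vect}(1)$ of polynomial vector fields $X=h\frac{d}{dx}$, $h\in\mathbb R[x]$, acts on $\mathcal F_\lambda$ by $L_X(f(dx)^\lambda)=(hf'+\lambda h'f)(dx)^\lambda$. Densities are multiplied by $f(dx)^\lambda\cdot g(dx)^\mu=fg(dx)^{\lambda+\mu}$, and $\mathcal F_0$ is the space of functions. A ternary differential operator $A:\mathcal F_\lambda\otimes\mathcal F_\gamma\otimes\mathcal F_\tau\to\mathcal F_\mu$ is $\mathfrak{vect}(1)$-invariant if $L_X A(a,b,c)=A(L_Xa,b,c)+A(a,L_Xb,c)+A(a,b,L_Xc)$ for all $X\in\mathfrak{vect}(1)$. An invariant operator of order $k$ has the form $\varphi(dx)^\lambda\otimes\psi(dx)^\gamma\otimes\chi(dx)^\tau\mapsto\sum_{i+j+l=k}\alpha_{i,j,l}\varphi^{(i)}\psi^{(j)}\chi^{(l)}(dx)^\mu$ with constants $\alpha_{i,j,l}\in\mathbb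 R$ and $\mu=\lambda+\gamma+\tau+k$. De Rham differential: $d:\mathcal F_0\to\mathcal F_1$, $d\varphi=\varphi'dx$. Poisson bracket: $\{\varphi(dx)^\lambda,\psi(dx)^\mu\}=(-\lambda\varphi\psi'+\mu\varphi'\psi)(dx)^{\lambda+\mu+1}$. Grozman operator: $\mathrm{Gz}:\mathcal F_{-2/3}\otimes\mathcal F_{-2/3}\to\mathcal F_{5/3}$, $\mathrm{Gz}(\varphi(dx)^{-2/3},\psi(dx)^{-2/3})=(2\varphi'''\psi+3\varphi''\psi'-3\varphi'\psi''-2\varphi\psi''')(dx)^{5/3}$. Dualizations: for $A=\sum\alpha_{i,j,l}\varphi^{(i)}\psi^{(j)}\chi^{(l)}$ from $\mathcal F_\lambda\otimes\mathcal F_\gamma\otimes\mathcal F_\tau$ to $\mathcal F_\mu$, the three dualizations are the formal adjoints (via integration by parts, $(\mathcal F_\alpha)^*:=\mathcal F_{1-\alpha}$) in each argument. $A^{*1}:\mathcal F_{1-\mu}\otimes\mathcal F_\gamma\otimes\mathcal F_\tau\to\mathcal F_{1-\lambda}$ is $(\omega,\psi,\chi)\mapsto\sum\alpha_{i,j,l}(-1)^i(\omega\psi^{(j)}\chi^{(l)})^{(i)}$; $A^{*2}:\mathcal F_\lambda\otimes\mathcal F_{1-\mu}\otimes\mathcal F_\tau\to\mathcal F_{1-\gamma}$ and $A^{*3}:\mathcal F_\lambda\otimes\mathcal F_\gamma\otimes\mathcal F_{1-\mu}\to\mathcal F_{1-\tau}$ are defined analogously. Permutations: for $\sigma\in S_3$,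 $A^\sigma(a,b,c)=A(\sigma^{-1}(a,b,c))$, with the weights permuted accordingly. "Up to permutations and dualizations" means after applying finitely many of these operations. The operator $\Delta_{\lambda,\gamma,\tau;3}:\mathcal F_\lambda\otimes\mathcal F_\gamma\otimes\mathcal F_\tau\to\mathcal F_{\lambda+\gamma+\tau+3}$ is $\sum_{i+j+l=3}\alpha_{i,j,l}\varphi^{(i)}\psi^{(j)}\chi^{(l)}(dx)^{\lambda+\gamma+\tau+3}$ with $\alpha_{3,0,0}=\gamma\tau(\tau-\gamma)(1+\gamma+\tau)$, $\alpha_{0,3,0}=\lambda\tau(\lambda-\tau)(1+\lambda+\tau)$, $\alpha_{0,0,3}=\gamma\lambda(\gamma-\lambda)(1+\gamma+\lambda)$, $\alpha_{1,1,1}=(\lambda-\gamma)(\gamma-\tau)(\lambda-\tau)$, $\alpha_{2,1,0}=\tau(1+\gamma+\tau)(2\lambda+\tau+\gamma(3\lambda+3\tau+4)+2)$, $\alpha_{1,2,0}=-\tau(1+\lambda+\tau)(2\gamma+\tau+\lambda(3\gamma+3\tau+4)+2)$, $\alpha_{2,0,1}=-\gamma(1+\gamma+\tau)(\gamma+2\lambda+(3\gamma+3\lambda+4)\tau+2)$, $\alpha_{1,0,2}=\gamma(1+\gamma+\lambda)(\gamma+2\tau+\lambda(3\gamma+3\tau+4)+2)$, $\alpha_{0,2,1}=\lambda(1+\lambda+\tau)(2\gamma+\lambda+(3\gamma+3\lambda+4)\tau+2)$, $\alpha_{0,1,2}=-\lambda(1+\gamma+\lambda)(\lambda+2\tau+\gamma(3\lambda+3\tau+4)+2)$.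 In case (3) it is taken with weights $(\lambda,1,\tau)$. For $\tau\neq-\frac34$, $\Xi:\mathcal F_{-\tau-3/2}\otimes\mathcal F_\tau\otimes\mathcal F_\tau\to\mathcal F_{\tau+5/2}$ is $\sum_{i+j+l=4}\alpha_{i,j,l}\varphi^{(i)}\psi^{(j)}\chi^{(l)}(dx)^{\tau+5/2}$ with $\alpha_{4,0,0}=\alpha_{0,2,2}=\alpha_{2,1,1}=0$, $\alpha_{0,4,0}=-\tau(3+2\tau)$, $\alpha_{0,0,4}=\tau(3+2\tau)$, $\alpha_{3,1,0}=-\frac83\tau(2+3\tau)$, $\alpha_{3,0,1}=\frac83\tau(2+3\tau)$, $\alpha_{1,3,0}=-\frac23\tau(13+12\tau)$, $\alpha_{1,0,3}=\frac23\tau(13+12\tau)$, $\alpha_{0,3,1}=\frac53(3+2\tau)$, $\alpha_{0,1,3}=-\frac53(3+2\tau)$, $\alpha_{2,2,0}=-4\tau(2+3\tau)$, $\alpha_{2,0,2}=4\tau(2+3\tau)$, $\alpha_{1,2,1}=10(1+\tau)$, $\alpha_{1,1,2}=-10(1+\tau)$. For $s,t\in\mathbb R$, $\Xi_{s,t}:\mathcal F_{-3/4}\otimes\mathcal F_{-3/4}\otimes\mathcal F_{-3/4}\to\mathcal F_{7/4}$ is $\sum_{i+j+l=4}\alpha_{i,j,l}\varphi^{(i)}\psi^{(j)}\chi^{(l)}(dx)^{7/4}$ with $\alpha_{4,0,0}=t$, $\alpha_{0,4,0}=s$, $\alpha_{0,0,4}=-s-t$, $\alpha_{3,1,0}=\frac49(4t-s)$,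 $\alpha_{3,0,1}=\frac49(s+5t)$, $\alpha_{1,3,0}=\frac49(4s-t)$, $\alpha_{1,0,3}=-\frac49(4s+5t)$, $\alpha_{0,3,1}=\frac49(5s+t)$, $\alpha_{0,1,3}=-\frac49(5s+4t)$, $\alpha_{2,2,0}=-\frac23(s+t)$, $\alpha_{2,0,2}=\frac23s$, $\alpha_{0,2,2}=\frac23t$, $\alpha_{2,1,1}=\frac{20}9t$, $\alpha_{1,2,1}=\frac{20}9s$, $\alpha_{1,1,2}=-\frac{20}9(s+t)$. *)

theory Defs
  imports
    "HOL-Computational_Algebra.Polynomial"
    "HOL-Combinatorics.Permutations"
begin

text \<open>
  A density \<open>f (dx)^lam\<close> of weight \<open>lam\<close> is represented by its coefficient \<open>f :: real poly\<close>;
  the weight is carried as a separate real parameter.  Thus every space of densities has the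
  carrier \<open>real poly\<close> and the weights enter through the Lie derivative, the brackets, and the
  bookkeeping of weights under permutations and dualizations.
\<close>

type_synonym ternary = "real poly \<times> real poly \<times> real poly \<Rightarrow> real poly"

text \<open>Lie derivative of \<open>f (dx)^lam\<close> along \<open>h d/dx\<close>.\<close>

definition lie_der :: "real \<Rightarrow> real poly \<Rightarrow> real poly \<Rightarrow> real poly" where
  "lie_der lam h f = h * pderiv f + smult lam (pderiv h * f)"

definition jet :: "nat \<times> nat \<times> nat \<Rightarrow> ternary" where
  "jet = (\<lambda>(i, j, l) (\<phi>, \<psi>, \<chi>). (pderiv ^^ i) \<phi> * (pderiv ^^ j) \<psi> * (pderiv ^^ l) \<chi>)"

text \<open>
  Differential operators with polynomial coefficients, of order exactly \<open>k\<close>: some coefficient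
  of total order \<open>k\<close> does not vanish, so the zero operator has no order.
\<close>

definition diff_operator :: "nat \<Rightarrow> ternary \<Rightarrow> bool" where
  "diff_operator k A \<longleftrightarrow>
     (\<exists>a :: nat \<times> nat \<times> nat \<Rightarrow> real poly.
        (\<forall>x. A x = (\<Sum>(i, j, l) | i + j + l \<le> k. a (i, j, l) * jet (i, j, l) x)) \<and>
        (\<exists>i j l. i + j + l = k \<and> a (i, j, l) \<noteq> 0))"

definition vect1_invariant :: "real \<times> real \<times> real \<Rightarrow> real \<Rightarrow> ternary \<Rightarrow> bool" where
  "vect1_invariant = (\<lambda>(lam, \<gamma>, \<tau>) \<mu> A.
     \<forall>h a b c. lie_der \<mu> h (A (a, b, c)) =
       A (lie_der lam h a, b, c) + A (a, lie_der \<gamma> h b, c) + A (a, b, lie_der \<tau> h c))"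


text \<open>
  An operator together with the weights of its three arguments and of its value.
\<close>

type_synonym weighted_op = "(real \<times> real \<times> real) \<times> real \<times> ternary"

text \<open>
  The action of a permutation \<open>\<sigma>\<close> of the positions \<open>{0, 1, 2}\<close> on triples:
  the entry in position \<open>i\<close> is moved to position \<open>\<sigma> i\<close>.
\<close>

definition permute_triple :: "(nat \<Rightarrow> nat) \<Rightarrow> 'a \<times> 'a \<times> 'a \<Rightarrow> 'a \<times> 'a \<times> 'a" where
  "permute_triple \<sigma> = (\<lambda>(x, y, z).
     ([x, y, z] ! inv \<sigma> 0, [x, y, z] ! inv \<sigma> 1, [x, y, z] ! inv \<sigma> 2))"

text \<open>
  The homogeneous operator of order \<open>k\<close> with constant coefficients \<open>\<alpha>\<close>, followed by its
  formal adjoints with respect to the first, second and third argument.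
\<close>

definition const_op :: "nat \<Rightarrow> (nat \<times> nat \<times> nat \<Rightarrow> real) \<Rightarrow> ternary" where
  "const_op k \<alpha> = (\<lambda>x. \<Sum>(i, j, l) | i + j + l = k. smult (\<alpha> (i, j, l)) (jet (i, j, l) x))"

definition adjoint1 :: "nat \<Rightarrow> (nat \<times> nat \<times> nat \<Rightarrow> real) \<Rightarrow> ternary" where
  "adjoint1 k \<alpha> = (\<lambda>(\<omega>, \<psi>, \<chi>). \<Sum>(i, j, l) | i + j + l = k.
     smult (\<alpha> (i, j, l) * (-1) ^ i) ((pderiv ^^ i) (\<omega> * (pderiv ^^ j) \<psi> * (pderiv ^^ l) \<chi>)))"

definition adjoint2 :: "nat \<Rightarrow> (nat \<times> nat \<times> nat \<Rightarrow> real) \<Rightarrow> ternary" where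
  "adjoint2 k \<alpha> = (\<lambda>(\<phi>, \<omega>, \<chi>). \<Sum>(i, j, l) | i + j + l = k.
     smult (\<alpha> (i, j, l) * (-1) ^ j) ((pderiv ^^ j) ((pderiv ^^ i) \<phi> * \<omega> * (pderiv ^^ l) \<chi>)))"

definition adjoint3 :: "nat \<Rightarrow> (nat \<times> nat \<times> nat \<Rightarrow> real) \<Rightarrow> ternary" where
  "adjoint3 k \<alpha> = (\<lambda>(\<phi>, \<psi>, \<omega>). \<Sum>(i, j, l) | i + j + l = k.
     smult (\<alpha> (i, j, l) * (-1) ^ l) ((pderiv ^^ l) ((pderiv ^^ i) \<phi> * (pderiv ^^ j) \<psi> * \<omega>)))"

inductive perm_or_dual :: "weighted_op \<Rightarrow> weighted_op \<Rightarrow> bool" where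
  perm: "\<sigma> permutes {0, 1, 2} \<Longrightarrow>
    perm_or_dual (w, \<mu>, A) (permute_triple \<sigma> w, \<mu>, \<lambda>x. A (permute_triple (inv \<sigma>) x))"
| dual1: "perm_or_dual ((lam, \<gamma>, \<tau>), \<mu>, const_op k \<alpha>) ((1 - \<mu>, \<gamma>, \<tau>), 1 - lam, adjoint1 k \<alpha>)"
| dual2: "perm_or_dual ((lam, \<gamma>, \<tau>), \<mu>, const_op k \<alpha>) ((lam, 1 - \<mu>, \<tau>), 1 - \<gamma>, adjoint2 k \<alpha>)"
| dual3: "perm_or_dual ((lam, \<gamma>, \<tau>), \<mu>, const_op k \<alpha>) ((lam, \<gamma>, 1 - \<mu>), 1 - \<tau>, adjoint3 k \<alpha>)"

abbreviation up_to_perm_dual :: "weighted_op \<Rightarrow> weighted_op \<Rightarrow> bool" where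
  "up_to_perm_dual \<equiv> perm_or_dual\<^sup>*\<^sup>*"


text \<open>De Rham differential, from weight \<open>0\<close> to weight \<open>1\<close>.\<close>

definition de_rham :: "real poly \<Rightarrow> real poly" where
  "de_rham \<phi> = pderiv \<phi>"

text \<open>Poisson bracket, from weights \<open>lam\<close> and \<open>\<mu>\<close> to weight \<open>lam + \<mu> + 1\<close>.\<close>

definition poisson :: "real \<Rightarrow> real \<Rightarrow> real poly \<Rightarrow> real poly \<Rightarrow> real poly" where
  "poisson lam \<mu> \<phi> \<psi> = smult (- lam) (\<phi> * pderiv \<psi>) + smult \<mu> (pderiv \<phi> * \<psi>)"

text \<open>Grozman operator, from weights \<open>-2/3\<close> and \<open>-2/3\<close> to weight \<open>5/3\<close>.\<close>

definition grozman :: "real poly \<Rightarrow> real poly \<Rightarrow> real poly" where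
  "grozman \<phi> \<psi> =
     smult 2 ((pderiv ^^ 3) \<phi> * \<psi>) + smult 3 ((pderiv ^^ 2) \<phi> * pderiv \<psi>)
     - smult 3 (pderiv \<phi> * (pderiv ^^ 2) \<psi>) - smult 2 (\<phi> * (pderiv ^^ 3) \<psi>)"

definition Delta3 :: "real \<Rightarrow> real \<Rightarrow> real \<Rightarrow> ternary" where
  "Delta3 lam \<gamma> \<tau> = (\<lambda>x.
     smult (\<gamma> * \<tau> * (\<tau> - \<gamma>) * (1 + \<gamma> + \<tau>)) (jet (3, 0, 0) x)
   + smult (lam * \<tau> * (lam - \<tau>) * (1 + lam + \<tau>)) (jet (0, 3, 0) x)
   + smult (\<gamma> * lam * (\<gamma> - lam) * (1 + \<gamma> + lam)) (jet (0, 0, 3) x)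
   + smult ((lam - \<gamma>) * (\<gamma> - \<tau>) * (lam - \<tau>)) (jet (1, 1, 1) x)
   + smult (\<tau> * (1 + \<gamma> + \<tau>) * (2 * lam + \<tau> + \<gamma> * (3 * lam + 3 * \<tau> + 4) + 2)) (jet (2, 1, 0) x)
   + smult (- \<tau> * (1 + lam + \<tau>) * (2 * \<gamma> + \<tau> + lam * (3 * \<gamma> + 3 * \<tau> + 4) + 2)) (jet (1, 2, 0) x)
   + smult (- \<gamma> * (1 + \<gamma> + \<tau>) * (\<gamma> + 2 * lam + (3 * \<gamma> + 3 * lam + 4) * \<tau> + 2)) (jet (2, 0, 1) x)
   + smult (\<gamma> * (1 + \<gamma> + lam) * (\<gamma> + 2 * \<tau> + lam * (3 * \<gamma> + 3 * \<tau> + 4) + 2)) (jet (1, 0, 2) x)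
   + smult (lam * (1 + lam + \<tau>) * (2 * \<gamma> + lam + (3 * \<gamma> + 3 * lam + 4) * \<tau> + 2)) (jet (0, 2, 1) x)
   + smult (- lam * (1 + \<gamma> + lam) * (lam + 2 * \<tau> + \<gamma> * (3 * lam + 3 * \<tau> + 4) + 2)) (jet (0, 1, 2) x))"

text \<open>On weights \<open>(-\<tau> - 3/2, \<tau>, \<tau>)\<close>, with values of weight \<open>\<tau> + 5/2\<close>.\<close>

definition Xi :: "real \<Rightarrow> ternary" where
  "Xi \<tau> = (\<lambda>x.
     smult (- \<tau> * (3 + 2 * \<tau>)) (jet (0, 4, 0) x)
   + smult (\<tau> * (3 + 2 * \<tau>)) (jet (0, 0, 4) x)
   + smult (- (8/3) * \<tau> * (2 + 3 * \<tau>)) (jet (3, 1, 0) x)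
   + smult ((8/3) * \<tau> * (2 + 3 * \<tau>)) (jet (3, 0, 1) x)
   + smult (- (2/3) * \<tau> * (13 + 12 * \<tau>)) (jet (1, 3, 0) x)
   + smult ((2/3) * \<tau> * (13 + 12 * \<tau>)) (jet (1, 0, 3) x)
   + smult ((5/3) * (3 + 2 * \<tau>)) (jet (0, 3, 1) x)
   + smult (- (5/3) * (3 + 2 * \<tau>)) (jet (0, 1, 3) x)
   + smult (- 4 * \<tau> * (2 + 3 * \<tau>)) (jet (2, 2, 0) x)
   + smult (4 * \<tau> * (2 + 3 * \<tau>)) (jet (2, 0, 2) x)
   + smult (10 * (1 + \<tau>)) (jet (1, 2, 1) x)
   + smult (- 10 * (1 + \<tau>)) (jet (1, 1, 2) x))"

text \<open>On weights \<open>(-3/4, -3/4, -3/4)\<close>, with values of weight \<open>7/4\<close>.\<close>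

definition Xi_st :: "real \<Rightarrow> real \<Rightarrow> ternary" where
  "Xi_st s t = (\<lambda>x.
     smult t (jet (4, 0, 0) x)
   + smult s (jet (0, 4, 0) x)
   + smult (- s - t) (jet (0, 0, 4) x)
   + smult ((4/9) * (4 * t - s)) (jet (3, 1, 0) x)
   + smult ((4/9) * (s + 5 * t)) (jet (3, 0, 1) x)
   + smult ((4/9) * (4 * s - t)) (jet (1, 3, 0) x)
   + smult (- (4/9) * (4 * s + 5 * t)) (jet (1, 0, 3) x)
   + smult ((4/9) * (5 * s + t)) (jet (0, 3, 1) x)
   + smult (- (4/9) * (5 * s + 4 * t)) (jet (0, 1, 3) x)
   + smult (- (2/3) * (s + t)) (jet (2, 2, 0) x)
   + smult ((2/3) * s) (jet (2, 0, 2) x)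
   + smult ((2/3) * t) (jet (0, 2, 2) x)
   + smult ((20/9) * t) (jet (2, 1, 1) x)
   + smult ((20/9) * s) (jet (1, 2, 1) x)
   + smult (- (20/9) * (s + t)) (jet (1, 1, 2) x))"

end

theory Submission
  imports Defs
begin

text \<open>
Evaluating an invariant operator at the origin on the monomials \<open>x ^ i\<close>, \<open>x ^ j\<close>, \<open>x ^ l\<close> gives numbers
\<open>\<beta> i j l\<close>, its moments.  The fields \<open>d/dx\<close> and \<open>x d/dx\<close> make the operator a constant coefficient one,
homogeneous of order 4, so it is determined by the 15 moments with \<open>i + j + l = 4\<close>; the field
\<open>x ^ p d/dx\<close> with \<open>p \<ge> 2\<close> vanishes to second order at the origin and turns invariance into linear
equations between the moments, with coefficients depending on the weights.  The theorem amounts to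
solving these 20 equations for all weights (\<open>invariant_imp_moment_op\<close>).

An operator with weights \<open>(a, b, c)\<close> and value of weight \<open>\<mu>\<close> is a 4-linear invariant form with
weights \<open>a\<close>, \<open>b\<close>, \<open>c\<close> and \<open>d = 1 - \<mu>\<close>, and order 4 means \<open>a + b + c + d = -3\<close>.  Permutations and
dualizations permute the four weights arbitrarily: the adjoint in the third argument exchanges \<open>c\<close>
and \<open>d\<close> (\<open>all_classified_swap34\<close>).  The problem is therefore symmetric in \<open>a, b, c, d\<close>, and it is
enough to treat one arrangement of each quadruple of weights.

If \<open>c \<noteq> 0\<close>, the equations express every moment through the five moments \<open>\<beta> i j 0\<close>, and what is left
are short relations between these five (\<open>binary_part_relations\<close>).  When none of the four weights
vanishes, dividing the relations by the weights leaves two unknowns \<open>v\<close>, \<open>w\<close> and three equations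
(\<open>nonzero_weights_solution\<close>).  In the shifted weights \<open>3 a + 2, ..., 3 d + 2\<close>, whose sum is \<open>-1\<close>,
these equations factor so well that a nonzero solution forces either two weights to be \<open>-2/3\<close>, the
weight of the Grozman operator, or the four weights to form two pairs of equal ones
(\<open>weights_without_zero\<close>).  The first alternative gives \<open>{Gz, \<chi>}\<close> and, if a third weight is \<open>-2/3\<close>,
a two-dimensional space; the second gives \<open>\<Xi>\<close> and, if all four weights agree, the family
\<open>\<Xi>\<^sub>s\<^sub>,\<^sub>t\<close>.  When exactly one weight vanishes, the operator factors through the de Rham differential of
the corresponding argument and the solution is a multiple of \<open>\<Delta>\<close>, except that \<open>\<Delta>\<close> itself vanishes
when the other three weights are \<open>-2, -2, 1\<close>; there, and when two weights vanish, the space of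
solutions is two-dimensional.
\<close>

section \<open>Invariant operators as solutions of linear equations\<close>

text \<open>
The homogeneous operator of order 4 with value \<open>\<beta> i j l\<close> at the origin on the monomials
\<open>(x ^ i, x ^ j, x ^ l)\<close>.  In this normalization the invariance equations have no binomial
coefficients.
\<close>

definition moment_op :: "(nat \<Rightarrow> nat \<Rightarrow> nat \<Rightarrow> real) \<Rightarrow> ternary" where
  "moment_op \<beta> = const_op 4 (\<lambda>(i, j, l). \<beta> i j l / (fact i * fact j * fact l))"

text \<open>
The Lie derivative along \<open>x ^ p d/dx\<close> sends the density \<open>x ^ i\<close> of weight \<open>a\<close> to
\<open>(i + p a) x ^ (i + p - 1)\<close>, and for \<open>p \<ge> 2\<close> the Lie derivative of the value vanishes at the origin.
The equation says that the sum of the three remaining terms vanishes.  The fields with \<open>p = 2, 3\<close>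
generate the others; keeping \<open>p = 4, 5\<close> makes it possible to solve for the moments without
dividing by anything but a weight.
\<close>

definition invariance_eqs :: "real \<Rightarrow> real \<Rightarrow> real \<Rightarrow> (nat \<Rightarrow> nat \<Rightarrow> nat \<Rightarrow> real) \<Rightarrow> bool" where
  "invariance_eqs a b c \<beta> \<longleftrightarrow> (\<forall>p i j l. 2 \<le> p \<and> i + j + l + p = 5 \<longrightarrow>
     (i + p * a) * \<beta> (i + p - 1) j l + (j + p * b) * \<beta> i (j + p - 1) l
       + (l + p * c) * \<beta> i j (l + p - 1) = 0)"

lemma sum_over_triples:
  "(\<Sum>(i, j, l) | i + j + l = (k::nat). f i j l) = (\<Sum>i\<le>k. \<Sum>j\<le>k - i. f i j (k - i - j))"
proof -
  have "bij_betw (\<lambda>(i, j). (i, j, k - i - j)) (SIGMA i:{..k}. {..k - i}) {(i, j, l). i + j + l = k}"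
    by (rule bij_betwI[where g = "\<lambda>(i, j, l). (i, j)"]) auto
  then show ?thesis
    by (simp add: sum.Sigma sum.reindex_bij_betw[symmetric] split_def)
qed

lemma finite_triples: "finite {(i, j, l). i + j + l \<le> (k::nat)}"
  by (rule finite_subset[of _ "{..k} \<times> {..k} \<times> {..k}"]) auto

lemma poly_higher_pderiv_power_0:
  "poly ((pderiv ^^ m) ([:0, 1:] ^ n)) 0 = (if m = n then fact n else (0::real))"
proof (induction m arbitrary: n)
  case 0
  then show ?case by (simp add: power_0_left)
next
  case (Suc m)
  show ?case
  proof (cases n)
    case 0
    then show ?thesis by (simp add: funpow_Suc_right del: funpow.simps)
  next
    case n: (Suc k)
    have "pderiv ([:0, 1::real:] ^ n) = smult (real n) ([:0, 1:] ^ k)"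
      unfolding n by (subst pderiv_power_Suc) (simp add: pderiv_pCons)
    then show ?thesis
      using Suc.IH[of k] by (simp add: funpow_Suc_right higher_pderiv_smult n del: funpow.simps)
  qed
qed

lemma poly_jets_at_monomials:
  fixes g :: "nat \<Rightarrow> nat \<Rightarrow> nat \<Rightarrow> real poly"
  assumes "i + j + l \<le> k"
  shows "poly (\<Sum>(i', j', l') | i' + j' + l' \<le> k. g i' j' l' * jet (i', j', l')
            (smult r ([:0, 1:] ^ i), smult s ([:0, 1:] ^ j), smult t ([:0, 1:] ^ l))) 0
         = r * s * t * (fact i * fact j * fact l) * poly (g i j l) 0"
proof -
  have "poly (\<Sum>(i', j', l') | i' + j' + l' \<le> k. g i' j' l' * jet (i', j', l')
            (smult r ([:0, 1:] ^ i), smult s ([:0, 1:] ^ j), smult t ([:0, 1:] ^ l))) 0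
      = (\<Sum>x\<in>{(i', j', l'). i' + j' + l' \<le> k}. if x = (i, j, l)
           then r * s * t * (fact i * fact j * fact l) * poly (g i j l) 0 else 0)"
    unfolding poly_sum
    by (rule sum.cong) (auto simp: jet_def higher_pderiv_smult poly_higher_pderiv_power_0 split: if_splits)
  also have "\<dots> = r * s * t * (fact i * fact j * fact l) * poly (g i j l) 0"
    using assms finite_triples[of k] by (simp add: sum.delta)
  finally show ?thesis .
qed

lemma pderiv_jet:
  "pderiv (jet (i, j, l) (\<phi>, \<psi>, \<chi>)) = jet (i, j, l) (pderiv \<phi>, \<psi>, \<chi>)
     + jet (i, j, l) (\<phi>, pderiv \<psi>, \<chi>) + jet (i, j, l) (\<phi>, \<psi>, pderiv \<chi>)"
  by (simp add: jet_def pderiv_mult funpow_swap1 algebra_simps)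

text \<open>
Evaluation of the relation at the origin on monomials only controls the coefficients at the origin.
Differentiating the relation yields the same relation for the derivatives of the coefficients,
because the terms in which a jet is differentiated are the relation for other arguments; hence all
Taylor coefficients vanish.
\<close>

lemma jets_independent:
  fixes g :: "nat \<Rightarrow> nat \<Rightarrow> nat \<Rightarrow> real poly"
  assumes "\<And>x. (\<Sum>(i, j, l) | i + j + l \<le> k. g i j l * jet (i, j, l) x) = 0"
    and "i + j + l \<le> k"
  shows "g i j l = 0"
proof -
  have vanish: "(\<Sum>(i, j, l) | i + j + l \<le> k. (pderiv ^^ n) (g i j l) * jet (i, j, l) x) = 0" for n x
  proof (induction n arbitrary: x)
    case 0
    then show ?case using assms(1) by simp
  next
    case (Suc n)
    obtain \<phi> \<psi> \<chi> where x: "x = (\<phi>, \<psi>, \<chi>)" by (metis prod_cases3)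
    have "0 = pderiv (\<Sum>(i, j, l) | i + j + l \<le> k. (pderiv ^^ n) (g i j l) * jet (i, j, l) x)"
      by (simp add: Suc.IH)
    also have "\<dots> = (\<Sum>(i, j, l) | i + j + l \<le> k. (pderiv ^^ Suc n) (g i j l) * jet (i, j, l) x)
       + (\<Sum>(i, j, l) | i + j + l \<le> k. (pderiv ^^ n) (g i j l) * jet (i, j, l) (pderiv \<phi>, \<psi>, \<chi>))
       + (\<Sum>(i, j, l) | i + j + l \<le> k. (pderiv ^^ n) (g i j l) * jet (i, j, l) (\<phi>, pderiv \<psi>, \<chi>))
       + (\<Sum>(i, j, l) | i + j + l \<le> k. (pderiv ^^ n) (g i j l) * jet (i, j, l) (\<phi>, \<psi>, pderiv \<chi>))"
      by (auto simp: x higher_pderiv_sum[where n = 1, simplified] sum.distrib[symmetric]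
          pderiv_mult pderiv_jet algebra_simps intro!: sum.cong)
    finally show ?case by (simp only: Suc.IH add_0_right)
  qed
  have "coeff (g i j l) n = 0" for n
  proof -
    have "poly ((pderiv ^^ n) (g i j l)) 0 = 0"
      using poly_jets_at_monomials[OF assms(2), of "\<lambda>i j l. (pderiv ^^ n) (g i j l)" 1 1 1] vanish[of n]
      by simp
    moreover have "poly ((pderiv ^^ n) (g i j l)) 0 = pochhammer (of_nat (Suc 0)) n * coeff (g i j l) n"
      by (simp add: poly_0_coeff_0 coeff_higher_pderiv)
    ultimately show ?thesis by (simp add: pochhammer_fact[symmetric])
  qed
  then show ?thesis by (simp add: poly_eq_iff)
qed

lemma moment_op_as_jets:
  "moment_op \<beta> x = (\<Sum>(i, j, l) | i + j + l \<le> 4. (if i + j + l = 4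
       then [:\<beta> i j l / (fact i * fact j * fact l):] else 0) * jet (i, j, l) x)"
proof -
  have "(\<Sum>(i, j, l) | i + j + l \<le> (4::nat). (if i + j + l = 4
       then [:\<beta> i j l / (fact i * fact j * fact l):] else 0) * jet (i, j, l) x)
     = (\<Sum>(i, j, l) | i + j + l = 4. smult (\<beta> i j l / (fact i * fact j * fact l)) (jet (i, j, l) x))"
    by (rule sum.mono_neutral_cong_right) (auto simp: finite_triples split: if_splits)
  then show ?thesis by (simp add: moment_op_def const_op_def split_def)
qed

lemma lie_der_monomial:
  assumes "p > 0"
  shows "lie_der a ([:0, 1:] ^ p) ([:0, 1:] ^ i) = smult (i + p * a) ([:0, 1:] ^ (i + p - 1))"
proof -
  obtain q where p: "p = Suc q" using assms by (cases p) auto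
  have pd: "pderiv ([:0, 1::real:] ^ Suc n) = smult (real (Suc n)) ([:0, 1:] ^ n)" for n
    by (subst pderiv_power_Suc) (simp add: pderiv_pCons)
  show ?thesis
  proof (cases i)
    case 0
    then show ?thesis by (simp add: lie_der_def p pd mult.commute del: power_Suc)
  next
    case (Suc k)
    have "[:0, 1::real:] ^ Suc q * [:0, 1:] ^ k = [:0, 1:] ^ (q + Suc k)"
      "[:0, 1::real:] ^ q * [:0, 1:] ^ Suc k = [:0, 1:] ^ (q + Suc k)"
      by (simp_all add: power_add algebra_simps)
    then show ?thesis
      by (simp add: lie_der_def p pd Suc smult_add_left[symmetric] algebra_simps del: power_Suc)
  qed
qed

lemma invariant_imp_moment_op:
  assumes op: "diff_operator 4 A" and inv: "vect1_invariant (a, b, c) (a + b + c + 4) A"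
  shows "\<exists>\<beta>. A = moment_op \<beta> \<and> invariance_eqs a b c \<beta> \<and> (\<exists>i j l. i + j + l = 4 \<and> \<beta> i j l \<noteq> 0)"
proof -
  obtain g0 where A0: "\<And>x. A x = (\<Sum>(i, j, l) | i + j + l \<le> 4. g0 (i, j, l) * jet (i, j, l) x)"
    and top: "\<exists>i j l. i + j + l = 4 \<and> g0 (i, j, l) \<noteq> 0"
    using op unfolding diff_operator_def by blast
  define g where "g = (\<lambda>i j l. g0 (i, j, l))"
  have A: "A x = (\<Sum>(i, j, l) | i + j + l \<le> 4. g i j l * jet (i, j, l) x)" for x
    by (simp add: A0 g_def)
  have lie: "lie_der (a + b + c + 4) h (A (u, v, w)) =
       A (lie_der a h u, v, w) + A (u, lie_der b h v, w) + A (u, v, lie_der c h w)" for h u v w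
    using inv unfolding vect1_invariant_def by simp
  \<comment> \<open>The translations \<open>h = 1\<close> force the coefficients to be constant.\<close>
  have "(\<Sum>(i, j, l) | i + j + l \<le> 4. pderiv (g i j l) * jet (i, j, l) x) = 0" for x
  proof -
    obtain u v w where x: "x = (u, v, w)" by (metis prod_cases3)
    have "pderiv (A (u, v, w)) = (\<Sum>(i, j, l) | i + j + l \<le> 4. pderiv (g i j l) * jet (i, j, l) x)
       + A (pderiv u, v, w) + A (u, pderiv v, w) + A (u, v, pderiv w)"
      unfolding A
      by (auto simp: x higher_pderiv_sum[where n = 1, simplified] sum.distrib[symmetric]
          pderiv_mult pderiv_jet algebra_simps intro!: sum.cong)
    moreover have "pderiv (A (u, v, w)) = A (pderiv u, v, w) + A (u, pderiv v, w) + A (u, v, pderiv w)"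
      using lie[of 1 u v w] by (simp add: lie_der_def)
    ultimately show ?thesis by simp
  qed
  then have "pderiv (g i j l) = 0" if "i + j + l \<le> 4" for i j l
    using jets_independent[where k = 4 and g = "\<lambda>i j l. pderiv (g i j l)"] that by blast
  then have const: "g i j l = [:poly (g i j l) 0:]" if "i + j + l \<le> 4" for i j l
    using degree_eq_zeroE[of "g i j l"] that by (metis pderiv_eq_0_iff poly_0 poly_pCons mult_zero_left add_0_right)
  define G where "G i j l = poly (g i j l) 0" for i j l
  have val: "poly (A (smult r ([:0, 1:] ^ i), smult s ([:0, 1:] ^ j), smult t ([:0, 1:] ^ l))) 0
      = r * s * t * (fact i * fact j * fact l) * G i j l" if "i + j + l \<le> 4" for i j l r s t
    unfolding A G_def by (rule poly_jets_at_monomials[OF that])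
  have vals: "poly (A (smult r ([:0, 1:] ^ i), [:0, 1:] ^ j, [:0, 1:] ^ l)) 0
      = r * (fact i * fact j * fact l) * G i j l"
    "poly (A ([:0, 1:] ^ i, smult r ([:0, 1:] ^ j), [:0, 1:] ^ l)) 0
      = r * (fact i * fact j * fact l) * G i j l"
    "poly (A ([:0, 1:] ^ i, [:0, 1:] ^ j, smult r ([:0, 1:] ^ l))) 0
      = r * (fact i * fact j * fact l) * G i j l"
    if "i + j + l \<le> 4" for i j l r
    using val[OF that, of r 1 1] val[OF that, of 1 r 1] val[OF that, of 1 1 r] by simp_all
  \<comment> \<open>The dilation \<open>h = x\<close> forces homogeneity.\<close>
  have hom: "G i j l = 0" if "i + j + l < 4" for i j l
  proof -
    have "poly (lie_der (a + b + c + 4) ([:0, 1:] ^ 1) (A ([:0, 1:] ^ i, [:0, 1:] ^ j, [:0, 1:] ^ l))) 0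
      = (a + b + c + 4) * (fact i * fact j * fact l) * G i j l"
      using vals(1)[of i j l 1] that by (simp add: lie_der_def pderiv_pCons)
    moreover have "poly (lie_der (a + b + c + 4) ([:0, 1:] ^ 1) (A ([:0, 1:] ^ i, [:0, 1:] ^ j, [:0, 1:] ^ l))) 0
      = (i + a + (j + b) + (l + c)) * (fact i * fact j * fact l) * G i j l"
      unfolding lie using that
      by (simp add: lie_der_monomial[of 1, simplified] vals distrib_right)
    ultimately have "(4 - real (i + j + l)) * (fact i * fact j * fact l) * G i j l = 0"
      by (simp add: algebra_simps)
    moreover have "4 - real (i + j + l) \<noteq> 0" using that by linarith
    ultimately show ?thesis by simp
  qed
  define \<beta> where "\<beta> i j l = fact i * fact j * fact l * G i j l" for i j l
  have "A x = moment_op \<beta> x" for x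
    unfolding A moment_op_as_jets
  proof (rule sum.cong[OF refl], safe)
    fix i j l :: nat
    assume *: "i + j + l \<le> 4"
    show "g i j l * jet (i, j, l) x = (if i + j + l = 4
       then [:\<beta> i j l / (fact i * fact j * fact l):] else 0) * jet (i, j, l) x"
      using const[OF *] hom[of i j l] * by (auto simp: G_def \<beta>_def)
  qed
  moreover have "invariance_eqs a b c \<beta>"
    unfolding invariance_eqs_def
  proof safe
    fix p i j l :: nat
    assume p: "2 \<le> p" and sum: "i + j + l + p = 5"
    then have "0 < p" and le: "i + p - 1 + j + l \<le> 4" "i + (j + p - 1) + l \<le> 4" "i + j + (l + p - 1) \<le> 4"
      by linarith+
    have "poly (lie_der (a + b + c + 4) ([:0, 1:] ^ p) F) 0 = 0" for F
    proof -
      obtain q where "p = Suc (Suc q)" using p by (metis add_2_eq_Suc le_Suc_ex)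
      then show ?thesis by (simp add: lie_der_def pderiv_power_Suc del: power_Suc)
    qed
    then have "poly (A (lie_der a ([:0, 1:] ^ p) ([:0, 1:] ^ i), [:0, 1:] ^ j, [:0, 1:] ^ l)
       + A ([:0, 1:] ^ i, lie_der b ([:0, 1:] ^ p) ([:0, 1:] ^ j), [:0, 1:] ^ l)
       + A ([:0, 1:] ^ i, [:0, 1:] ^ j, lie_der c ([:0, 1:] ^ p) ([:0, 1:] ^ l))) 0 = 0"
      using lie by metis
    then show "(i + p * a) * \<beta> (i + p - 1) j l + (j + p * b) * \<beta> i (j + p - 1) l
       + (l + p * c) * \<beta> i j (l + p - 1) = 0"
      unfolding lie_der_monomial[OF \<open>0 < p\<close>] poly_add vals(1)[OF le(1)] vals(2)[OF le(2)] vals(3)[OF le(3)] \<beta>_def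
      by (simp add: mult.assoc)
  qed
  moreover have "\<exists>i j l. i + j + l = 4 \<and> \<beta> i j l \<noteq> 0"
    using top const unfolding \<beta>_def G_def g_def by (metis fact_nonzero le_refl mult_eq_0_iff pCons_0_0)
  ultimately show ?thesis by blast
qed

text \<open>
The equations in full, as needed for elimination: ten for \<open>p = 2\<close>, six for \<open>p = 3\<close>, three for \<open>p = 4\<close>
and one for \<open>p = 5\<close>.
\<close>

lemma invariance_eqs_iff:
  "invariance_eqs a b c \<beta> \<longleftrightarrow>
     (3 + 2 * a) * \<beta> 4 0 0 + 2 * b * \<beta> 3 1 0 + 2 * c * \<beta> 3 0 1 = 0 \<and>
     (2 + 2 * a) * \<beta> 3 1 0 + (1 + 2 * b) * \<beta> 2 2 0 + 2 * c * \<beta> 2 1 1 = 0 \<and>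
     (2 + 2 * a) * \<beta> 3 0 1 + 2 * b * \<beta> 2 1 1 + (1 + 2 * c) * \<beta> 2 0 2 = 0 \<and>
     (1 + 2 * a) * \<beta> 2 2 0 + (2 + 2 * b) * \<beta> 1 3 0 + 2 * c * \<beta> 1 2 1 = 0 \<and>
     (1 + 2 * a) * \<beta> 2 1 1 + (1 + 2 * b) * \<beta> 1 2 1 + (1 + 2 * c) * \<beta> 1 1 2 = 0 \<and>
     (1 + 2 * a) * \<beta> 2 0 2 + 2 * b * \<beta> 1 1 2 + (2 + 2 * c) * \<beta> 1 0 3 = 0 \<and>
     2 * a * \<beta> 1 3 0 + (3 + 2 * b) * \<beta> 0 4 0 + 2 * c * \<beta> 0 3 1 = 0 \<and>
     2 * a * \<beta> 1 2 1 + (2 + 2 * b) * \<beta> 0 3 1 + (1 + 2 * c) * \<beta> 0 2 2 = 0 \<and>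
     2 * a * \<beta> 1 1 2 + (1 + 2 * b) * \<beta> 0 2 2 + (2 + 2 * c) * \<beta> 0 1 3 = 0 \<and>
     2 * a * \<beta> 1 0 3 + 2 * b * \<beta> 0 1 3 + (3 + 2 * c) * \<beta> 0 0 4 = 0 \<and>
     (2 + 3 * a) * \<beta> 4 0 0 + 3 * b * \<beta> 2 2 0 + 3 * c * \<beta> 2 0 2 = 0 \<and>
     (1 + 3 * a) * \<beta> 3 1 0 + (1 + 3 * b) * \<beta> 1 3 0 + 3 * c * \<beta> 1 1 2 = 0 \<and>
     (1 + 3 * a) * \<beta> 3 0 1 + 3 * b * \<beta> 1 2 1 + (1 + 3 * c) * \<beta> 1 0 3 = 0 \<and>
     3 * a * \<beta> 2 2 0 + (2 + 3 * b) * \<beta> 0 4 0 + 3 * c * \<beta> 0 2 2 = 0 \<and>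
     3 * a * \<beta> 2 1 1 + (1 + 3 * b) * \<beta> 0 3 1 + (1 + 3 * c) * \<beta> 0 1 3 = 0 \<and>
     3 * a * \<beta> 2 0 2 + 3 * b * \<beta> 0 2 2 + (2 + 3 * c) * \<beta> 0 0 4 = 0 \<and>
     (1 + 4 * a) * \<beta> 4 0 0 + 4 * b * \<beta> 1 3 0 + 4 * c * \<beta> 1 0 3 = 0 \<and>
     4 * a * \<beta> 3 1 0 + (1 + 4 * b) * \<beta> 0 4 0 + 4 * c * \<beta> 0 1 3 = 0 \<and>
     4 * a * \<beta> 3 0 1 + 4 * b * \<beta> 0 3 1 + (1 + 4 * c) * \<beta> 0 0 4 = 0 \<and>
     5 * a * \<beta> 4 0 0 + 5 * b * \<beta> 0 4 0 + 5 * c * \<beta> 0 0 4 = 0"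
    (is "_ \<longleftrightarrow> ?R")
proof
  assume H: "invariance_eqs a b c \<beta>"
  show ?R
    using
      H[unfolded invariance_eqs_def, rule_format, of 2 3 0 0]
      H[unfolded invariance_eqs_def, rule_format, of 2 2 1 0]
      H[unfolded invariance_eqs_def, rule_format, of 2 2 0 1]
      H[unfolded invariance_eqs_def, rule_format, of 2 1 2 0]
      H[unfolded invariance_eqs_def, rule_format, of 2 1 1 1]
      H[unfolded invariance_eqs_def, rule_format, of 2 1 0 2]
      H[unfolded invariance_eqs_def, rule_format, of 2 0 3 0]
      H[unfolded invariance_eqs_def, rule_format, of 2 0 2 1]
      H[unfolded invariance_eqs_def, rule_format, of 2 0 1 2]
      H[unfolded invariance_eqs_def, rule_format, of 2 0 0 3]
      H[unfolded invariance_eqs_def, rule_format, of 3 2 0 0]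
      H[unfolded invariance_eqs_def, rule_format, of 3 1 1 0]
      H[unfolded invariance_eqs_def, rule_format, of 3 1 0 1]
      H[unfolded invariance_eqs_def, rule_format, of 3 0 2 0]
      H[unfolded invariance_eqs_def, rule_format, of 3 0 1 1]
      H[unfolded invariance_eqs_def, rule_format, of 3 0 0 2]
      H[unfolded invariance_eqs_def, rule_format, of 4 1 0 0]
      H[unfolded invariance_eqs_def, rule_format, of 4 0 1 0]
      H[unfolded invariance_eqs_def, rule_format, of 4 0 0 1]
      H[unfolded invariance_eqs_def, rule_format, of 5 0 0 0]
    by (simp del: One_nat_def add: One_nat_def[symmetric])
next
  assume R: ?R
  have "(i + p * a) * \<beta> (i + p - 1) j l + (j + p * b) * \<beta> i (j + p - 1) l
       + (l + p * c) * \<beta> i j (l + p - 1) = 0" if "2 \<le> p" "i + j + l + p = 5" for p i j l :: nat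
  proof -
    have "p = 2 \<or> p = 3 \<or> p = 4 \<or> p = 5" using that by arith
    moreover have "i = 0 \<or> i = 1 \<or> i = 2 \<or> i = 3" using that by arith
    moreover have "j = 0 \<or> j = 1 \<or> j = 2 \<or> j = 3" using that by arith
    moreover have "l = 5 - p - i - j" using that by arith
    ultimately show ?thesis using that(2) R by (elim disjE) (simp_all del: One_nat_def add: One_nat_def[symmetric])
  qed
  then show "invariance_eqs a b c \<beta>" unfolding invariance_eqs_def by blast
qed

lemma invariance_eqsD:
  assumes "invariance_eqs a b c \<beta>"
  shows "(3 + 2 * a) * \<beta> 4 0 0 + 2 * b * \<beta> 3 1 0 + 2 * c * \<beta> 3 0 1 = 0"
    "(2 + 2 * a) * \<beta> 3 1 0 + (1 + 2 * b) * \<beta> 2 2 0 + 2 * c * \<beta> 2 1 1 = 0"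
    "(2 + 2 * a) * \<beta> 3 0 1 + 2 * b * \<beta> 2 1 1 + (1 + 2 * c) * \<beta> 2 0 2 = 0"
    "(1 + 2 * a) * \<beta> 2 2 0 + (2 + 2 * b) * \<beta> 1 3 0 + 2 * c * \<beta> 1 2 1 = 0"
    "(1 + 2 * a) * \<beta> 2 1 1 + (1 + 2 * b) * \<beta> 1 2 1 + (1 + 2 * c) * \<beta> 1 1 2 = 0"
    "(1 + 2 * a) * \<beta> 2 0 2 + 2 * b * \<beta> 1 1 2 + (2 + 2 * c) * \<beta> 1 0 3 = 0"
    "2 * a * \<beta> 1 3 0 + (3 + 2 * b) * \<beta> 0 4 0 + 2 * c * \<beta> 0 3 1 = 0"
    "2 * a * \<beta> 1 2 1 + (2 + 2 * b) * \<beta> 0 3 1 + (1 + 2 * c) * \<beta> 0 2 2 = 0"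
    "2 * a * \<beta> 1 1 2 + (1 + 2 * b) * \<beta> 0 2 2 + (2 + 2 * c) * \<beta> 0 1 3 = 0"
    "2 * a * \<beta> 1 0 3 + 2 * b * \<beta> 0 1 3 + (3 + 2 * c) * \<beta> 0 0 4 = 0"
    "(2 + 3 * a) * \<beta> 4 0 0 + 3 * b * \<beta> 2 2 0 + 3 * c * \<beta> 2 0 2 = 0"
    "(1 + 3 * a) * \<beta> 3 1 0 + (1 + 3 * b) * \<beta> 1 3 0 + 3 * c * \<beta> 1 1 2 = 0"
    "(1 + 3 * a) * \<beta> 3 0 1 + 3 * b * \<beta> 1 2 1 + (1 + 3 * c) * \<beta> 1 0 3 = 0"
    "3 * a * \<beta> 2 2 0 + (2 + 3 * b) * \<beta> 0 4 0 + 3 * c * \<beta> 0 2 2 = 0"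
    "3 * a * \<beta> 2 1 1 + (1 + 3 * b) * \<beta> 0 3 1 + (1 + 3 * c) * \<beta> 0 1 3 = 0"
    "3 * a * \<beta> 2 0 2 + 3 * b * \<beta> 0 2 2 + (2 + 3 * c) * \<beta> 0 0 4 = 0"
    "(1 + 4 * a) * \<beta> 4 0 0 + 4 * b * \<beta> 1 3 0 + 4 * c * \<beta> 1 0 3 = 0"
    "4 * a * \<beta> 3 1 0 + (1 + 4 * b) * \<beta> 0 4 0 + 4 * c * \<beta> 0 1 3 = 0"
    "4 * a * \<beta> 3 0 1 + 4 * b * \<beta> 0 3 1 + (1 + 4 * c) * \<beta> 0 0 4 = 0"
    "5 * a * \<beta> 4 0 0 + 5 * b * \<beta> 0 4 0 + 5 * c * \<beta> 0 0 4 = 0"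
  using assms unfolding invariance_eqs_iff by blast+

section \<open>The action of the symmetric group on the four weights\<close>

definition canonical :: "real \<Rightarrow> real \<Rightarrow> real \<Rightarrow> ternary \<Rightarrow> bool" where
  "canonical lam \<gamma> \<tau> B \<longleftrightarrow>
      (\<gamma> = 0 \<and> lam = 0 \<and>
        (\<exists>\<epsilon>1 \<epsilon>2. \<forall>\<phi> \<psi> \<chi>. B (\<phi>, \<psi>, \<chi>) =
           smult \<epsilon>1 (poisson 3 \<tau> (poisson 1 1 (de_rham \<phi>) (de_rham \<psi>)) \<chi>)
         + smult \<epsilon>2 (poisson (\<tau> + 2) 1 (poisson \<tau> 1 \<chi> (de_rham \<phi>)) (de_rham \<psi>))))
    \<or> (lam = -2 \<and> \<gamma> = 0 \<and> \<tau> = -2 \<and>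
        (\<exists>\<epsilon>1 \<epsilon>2. \<forall>\<phi> \<psi> \<chi>. B (\<phi>, \<psi>, \<chi>) =
           smult \<epsilon>1 (poisson 1 (-2) (de_rham (poisson 1 (-2) (de_rham \<psi>) \<phi>)) \<chi>)
         + smult \<epsilon>2 (poisson 1 (-2) (de_rham (poisson 1 (-2) (de_rham \<psi>) \<chi>)) \<phi>)))
    \<or> (\<gamma> = 0 \<and> lam \<noteq> 0 \<and> \<tau> \<noteq> 0 \<and>
        (\<forall>\<phi> \<psi> \<chi>. B (\<phi>, \<psi>, \<chi>) = Delta3 lam 1 \<tau> (\<phi>, de_rham \<psi>, \<chi>)))
    \<or> (lam = -2/3 \<and> \<gamma> = -2/3 \<and> \<tau> \<noteq> -1 \<and>
        (\<forall>\<phi> \<psi> \<chi>. B (\<phi>, \<psi>, \<chi>) = poisson (5/3) \<tau> (grozman \<phi> \<psi>) \<chi>))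
    \<or> (lam = -1 \<and> \<gamma> = -2/3 \<and> \<tau> = -2/3 \<and>
        (\<exists>\<epsilon>1 \<epsilon>2. \<forall>\<phi> \<psi> \<chi>. B (\<phi>, \<psi>, \<chi>) =
           smult \<epsilon>1 (grozman (poisson (-1) (-2/3) \<phi> \<psi>) \<chi>)
         + smult \<epsilon>2 (grozman (poisson (-1) (-2/3) \<phi> \<chi>) \<psi>)))
    \<or> (lam = -3/2 - \<tau> \<and> \<gamma> = \<tau> \<and> \<tau> \<notin> {-3/2, -2/3, 0, -3/4} \<and>
        (\<forall>\<phi> \<psi> \<chi>. B (\<phi>, \<psi>, \<chi>) = Xi \<tau> (\<phi>, \<psi>, \<chi>)))
    \<or> (lam = -3/4 \<and> \<gamma> = -3/4 \<and> \<tau> = -3/4 \<and>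
        (\<exists>s t. \<forall>\<phi> \<psi> \<chi>. B (\<phi>, \<psi>, \<chi>) = Xi_st s t (\<phi>, \<psi>, \<chi>)))"

text \<open>
The conclusion of the classification for an operator, as a property that can be transported along
permutations and dualizations.
\<close>

definition classified :: "real \<times> real \<times> real \<Rightarrow> real \<Rightarrow> ternary \<Rightarrow> bool" where
  "classified w \<mu> A \<longleftrightarrow> (\<exists>lam' \<gamma>' \<tau>' \<mu>' c B.
     up_to_perm_dual (w, \<mu>, A) ((lam', \<gamma>', \<tau>'), \<mu>', \<lambda>x. smult c (B x)) \<and>
     \<mu>' = lam' + \<gamma>' + \<tau>' + 4 \<and> canonical lam' \<gamma>' \<tau>' B)"

lemma classified_step:
  assumes "perm_or_dual (w, \<mu>, A) (w', \<mu>', A')" "classified w' \<mu>' A'"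
  shows "classified w \<mu> A"
proof -
  obtain lam' \<gamma>' \<tau>' \<mu>'' c B where
    R: "up_to_perm_dual (w', \<mu>', A') ((lam', \<gamma>', \<tau>'), \<mu>'', \<lambda>x. smult c (B x))"
    and B: "\<mu>'' = lam' + \<gamma>' + \<tau>' + 4" "canonical lam' \<gamma>' \<tau>' B"
    using assms(2) unfolding classified_def by blast
  have "up_to_perm_dual (w, \<mu>, A) ((lam', \<gamma>', \<tau>'), \<mu>'', \<lambda>x. smult c (B x))"
    using assms(1) R by (rule converse_rtranclp_into_rtranclp)
  then show ?thesis
    using B unfolding classified_def by blast
qed

lemma classifiedI:
  assumes "canonical a b c B" "\<And>\<phi> \<psi> \<chi>. A (\<phi>, \<psi>, \<chi>) = smult k (B (\<phi>, \<psi>, \<chi>))"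
  shows "classified (a, b, c) (a + b + c + 4) A"
proof -
  have "A = (\<lambda>x. smult k (B x))"
    using assms(2) by (auto simp: fun_eq_iff)
  then show ?thesis
    using assms(1) unfolding classified_def by blast
qed

lemma higher_pderiv_numeral:
  fixes p :: "real poly"
  shows "(pderiv ^^ 2) p = pderiv (pderiv p)" "(pderiv ^^ 3) p = pderiv (pderiv (pderiv p))"
    "(pderiv ^^ 4) p = pderiv (pderiv (pderiv (pderiv p)))"
  by (simp_all add: eval_nat_numeral)

lemmas pderivs = higher_pderiv_numeral pderiv_mult pderiv_add pderiv_diff pderiv_minus pderiv_smult

lemma sum_atMost_upto_4:
  "(\<Sum>i\<le>4. f i) = f 0 + f 1 + f 2 + f 3 + f (4::nat)"
  "(\<Sum>i\<le>3. f i) = f 0 + f 1 + f 2 + f (3::nat)"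
  "(\<Sum>i\<le>2. f i) = f 0 + f 1 + f (2::nat)"
  "(\<Sum>i\<le>1. f i) = f 0 + f (1::nat)"
  "(\<Sum>i\<le>Suc 0. f i) = f 0 + f (1::nat)"
  by (simp_all add: eval_nat_numeral)

lemma moment_op_expand:
  "moment_op \<beta> (\<phi>, \<psi>, \<chi>) =
     smult (\<beta> 4 0 0 / 24) ((pderiv ^^ 4) \<phi> * \<psi> * \<chi>)
   + smult (\<beta> 0 4 0 / 24) (\<phi> * (pderiv ^^ 4) \<psi> * \<chi>)
   + smult (\<beta> 0 0 4 / 24) (\<phi> * \<psi> * (pderiv ^^ 4) \<chi>)
   + smult (\<beta> 3 1 0 / 6) ((pderiv ^^ 3) \<phi> * pderiv \<psi> * \<chi>)
   + smult (\<beta> 3 0 1 / 6) ((pderiv ^^ 3) \<phi> * \<psi> * pderiv \<chi>)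
   + smult (\<beta> 1 3 0 / 6) (pderiv \<phi> * (pderiv ^^ 3) \<psi> * \<chi>)
   + smult (\<beta> 0 3 1 / 6) (\<phi> * (pderiv ^^ 3) \<psi> * pderiv \<chi>)
   + smult (\<beta> 1 0 3 / 6) (pderiv \<phi> * \<psi> * (pderiv ^^ 3) \<chi>)
   + smult (\<beta> 0 1 3 / 6) (\<phi> * pderiv \<psi> * (pderiv ^^ 3) \<chi>)
   + smult (\<beta> 2 2 0 / 4) ((pderiv ^^ 2) \<phi> * (pderiv ^^ 2) \<psi> * \<chi>)
   + smult (\<beta> 2 0 2 / 4) ((pderiv ^^ 2) \<phi> * \<psi> * (pderiv ^^ 2) \<chi>)
   + smult (\<beta> 0 2 2 / 4) (\<phi> * (pderiv ^^ 2) \<psi> * (pderiv ^^ 2) \<chi>)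
   + smult (\<beta> 2 1 1 / 2) ((pderiv ^^ 2) \<phi> * pderiv \<psi> * pderiv \<chi>)
   + smult (\<beta> 1 2 1 / 2) (pderiv \<phi> * (pderiv ^^ 2) \<psi> * pderiv \<chi>)
   + smult (\<beta> 1 1 2 / 2) (pderiv \<phi> * pderiv \<psi> * (pderiv ^^ 2) \<chi>)"
proof -
  have *: "moment_op \<beta> (\<phi>, \<psi>, \<chi>) = (\<Sum>(i, j, l) | i + j + l = 4.
      smult (\<beta> i j l / (fact i * fact j * fact l)) (jet (i, j, l) (\<phi>, \<psi>, \<chi>)))"
    by (simp add: moment_op_def const_op_def split_def)
  show ?thesis
    unfolding * sum_over_triples
    by (simp add: sum_atMost_upto_4 jet_def fact_numeral add_ac)
qed

lemma perm_or_dual_swap12: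
  "perm_or_dual ((a, b, c), \<mu>, A) ((b, a, c), \<mu>, \<lambda>(\<phi>, \<psi>, \<chi>). A (\<psi>, \<phi>, \<chi>))"
proof -
  have s: "permute_triple (transpose 0 1) x = (case x of (\<phi>, \<psi>, \<chi>) \<Rightarrow> (\<psi>, \<phi>, \<chi>))" for x :: "'a \<times> 'a \<times> 'a"
    by (cases x) (simp add: permute_triple_def transpose_def)
  have "transpose 0 1 permutes {0, 1, 2::nat}"
    by (rule permutes_swap_id) auto
  from perm_or_dual.perm[OF this, of "(a, b, c)" \<mu> A] show ?thesis
    by (simp only: s inv_transpose_eq prod.case) (simp add: split_def)
qed

lemma perm_or_dual_swap23:
  "perm_or_dual ((a, b, c), \<mu>, A) ((a, c, b), \<mu>, \<lambda>(\<phi>, \<psi>, \<chi>). A (\<phi>, \<chi>, \<psi>))"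
proof -
  have s: "permute_triple (transpose 1 2) x = (case x of (\<phi>, \<psi>, \<chi>) \<Rightarrow> (\<phi>, \<chi>, \<psi>))" for x :: "'a \<times> 'a \<times> 'a"
    by (cases x) (simp add: permute_triple_def transpose_def)
  have "transpose 1 2 permutes {0, 1, 2::nat}"
    by (rule permutes_swap_id) auto
  from perm_or_dual.perm[OF this, of "(a, b, c)" \<mu> A] show ?thesis
    by (simp only: s inv_transpose_eq prod.case) (simp add: split_def)
qed

lemma moment_op_swap12:
  "(\<lambda>(\<phi>, \<psi>, \<chi>). moment_op \<beta> (\<psi>, \<phi>, \<chi>)) = moment_op (\<lambda>i j l. \<beta> j i l)"
  by (auto simp: fun_eq_iff moment_op_expand mult_ac add_ac)

lemma moment_op_swap23:
  "(\<lambda>(\<phi>, \<psi>, \<chi>). moment_op \<beta> (\<phi>, \<chi>, \<psi>)) = moment_op (\<lambda>i j l. \<beta> i l j)"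
  by (auto simp: fun_eq_iff moment_op_expand mult_ac add_ac)

lemma invariance_eqs_swap12:
  assumes "invariance_eqs a b c \<beta>"
  shows "invariance_eqs b a c (\<lambda>i j l. \<beta> j i l)"
  unfolding invariance_eqs_def
proof safe
  fix p i j l :: nat
  assume "2 \<le> p" "i + j + l + p = 5"
  then show "(i + p * b) * \<beta> j (i + p - 1) l + (j + p * a) * \<beta> (j + p - 1) i l
       + (l + p * c) * \<beta> j i (l + p - 1) = 0"
    using assms[unfolded invariance_eqs_def, rule_format, of p j i l] by (simp add: add.commute)
qed

lemma invariance_eqs_swap23:
  assumes "invariance_eqs a b c \<beta>"
  shows "invariance_eqs a c b (\<lambda>i j l. \<beta> i l j)"
  unfolding invariance_eqs_def
proof safe
  fix p i j l :: nat
  assume "2 \<le> p" "i + j + l + p = 5"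
  then show "(i + p * a) * \<beta> (i + p - 1) l j + (j + p * c) * \<beta> i l (j + p - 1)
       + (l + p * b) * \<beta> i (l + p - 1) j = 0"
    using assms[unfolded invariance_eqs_def, rule_format, of p i l j] by (simp add: algebra_simps)
qed

text \<open>
The moments of the adjoint in the third argument: the \<open>l\<close>-fold derivative in
\<open>(-1) ^ l (\<phi>\<^sup>(\<^sup>i\<^sup>) \<psi>\<^sup>(\<^sup>j\<^sup>) \<omega>)\<^sup>(\<^sup>l\<^sup>)\<close> is distributed by the Leibniz rule.  For \<open>i' + j' + l' = 4\<close> the
sign \<open>(-1) ^ l'\<close> equals \<open>(-1) ^ (i' + j')\<close>.
\<close>

definition dual_moments :: "(nat \<Rightarrow> nat \<Rightarrow> nat \<Rightarrow> real) \<Rightarrow> nat \<Rightarrow> nat \<Rightarrow> nat \<Rightarrow> real" where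
  "dual_moments \<beta> i j l = (\<Sum>i'\<le>i. \<Sum>j'\<le>j. (-1) ^ (i' + j') * real (i choose i') * real (j choose j')
     * \<beta> i' j' (4 - i' - j'))"

lemma small_binomials:
  "4 choose 2 = (6::nat)" "4 choose 3 = (4::nat)" "3 choose 2 = (3::nat)"
  by (simp_all add: eval_nat_numeral)

lemma adjoint3_moment_op:
  "adjoint3 4 (\<lambda>(i, j, l). \<beta> i j l / (fact i * fact j * fact l)) = moment_op (dual_moments \<beta>)"
proof -
  have "adjoint3 4 (\<lambda>(i, j, l). \<beta> i j l / (fact i * fact j * fact l)) (\<phi>, \<psi>, \<omega>)
      = moment_op (dual_moments \<beta>) (\<phi>, \<psi>, \<omega>)" for \<phi> \<psi> \<omega>
  proof -
    have *: "adjoint3 4 (\<lambda>(i, j, l). \<beta> i j l / (fact i * fact j * fact l)) (\<phi>, \<psi>, \<omega>)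
       = (\<Sum>(i, j, l) | i + j + l = 4. smult (\<beta> i j l / (fact i * fact j * fact l) * (-1) ^ l)
            ((pderiv ^^ l) ((pderiv ^^ i) \<phi> * (pderiv ^^ j) \<psi> * \<omega>)))"
      by (simp add: adjoint3_def split_def)
    show ?thesis
      unfolding * sum_over_triples moment_op_expand poly_eq_poly_eq_iff[symmetric]
      by (rule ext, simp add: dual_moments_def sum_atMost_upto_4 small_binomials fact_numeral pderivs)
        (simp add: field_simps)
  qed
  then show ?thesis by (simp add: fun_eq_iff)
qed

text \<open>
The adjoint of an invariant operator is invariant.  In terms of moments, the equation with indices
\<open>(p, i, j, l)\<close> for the adjoint is a combination with constant coefficients, again given by the Leibniz
rule, of the equations for \<open>\<beta>\<close> with the same \<open>p\<close>; so linear arithmetic finds it.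
\<close>

lemma invariance_eqs_dual:
  assumes "invariance_eqs a b c \<beta>" and d: "d = -3 - a - b - c"
  shows "invariance_eqs a b d (dual_moments \<beta>)"
proof -
  note e = invariance_eqsD[OF assms(1)]
  show ?thesis
    unfolding invariance_eqs_iff d using e
    by (intro conjI; simp add: dual_moments_def sum_atMost_upto_4 small_binomials;
        simp add: algebra_simps; linarith?)
qed

text \<open>
The fourth weight \<open>d\<close> is determined by the other three and is carried along because the
classification is symmetric in all four weights.
\<close>

definition all_classified :: "real \<Rightarrow> real \<Rightarrow> real \<Rightarrow> real \<Rightarrow> bool" where
  "all_classified a b c d \<longleftrightarrow> a + b + c + d = -3 \<and>
     (\<forall>\<beta>. invariance_eqs a b c \<beta> \<longrightarrow> classified (a, b, c) (a + b + c + 4) (moment_op \<beta>))"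

lemma all_classified_swap12:
  assumes "all_classified b a c d"
  shows "all_classified a b c d"
  unfolding all_classified_def
proof (intro conjI allI impI)
  fix \<beta> assume "invariance_eqs a b c \<beta>"
  then have "classified (b, a, c) (b + a + c + 4) (moment_op (\<lambda>i j l. \<beta> j i l))"
    using assms invariance_eqs_swap12 unfolding all_classified_def by blast
  then show "classified (a, b, c) (a + b + c + 4) (moment_op \<beta>)"
    using perm_or_dual_swap12[of a b c "a + b + c + 4" "moment_op \<beta>"]
    by (simp only: moment_op_swap12 add.commute[of b a] classified_step)
qed (use assms in \<open>simp add: all_classified_def\<close>)

lemma all_classified_swap23:
  assumes "all_classified a c b d"
  shows "all_classified a b c d"
  unfolding all_classified_def
proof (intro conjI allI impI)
  fix \<beta> assume "invariance_eqs a b c \<beta>"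
  then have "classified (a, c, b) (a + c + b + 4) (moment_op (\<lambda>i j l. \<beta> i l j))"
    using assms invariance_eqs_swap23 unfolding all_classified_def by blast
  then show "classified (a, b, c) (a + b + c + 4) (moment_op \<beta>)"
    using perm_or_dual_swap23[of a b c "a + b + c + 4" "moment_op \<beta>"]
    by (simp only: moment_op_swap23 add.commute[of c b] add.assoc[of a] classified_step)
qed (use assms in \<open>simp add: all_classified_def\<close>)

text \<open>
The value of the operator has weight \<open>\<mu> = a + b + c + 4\<close>, and \<open>1 - \<mu> = d\<close>; thus the adjoint in the third
argument has weights \<open>(a, b, d)\<close>.
\<close>

lemma all_classified_swap34:
  assumes "all_classified a b d c"
  shows "all_classified a b c d"
  unfolding all_classified_def
proof (intro conjI allI impI)
  have d: "d = -3 - a - b - c"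
    using assms by (simp add: all_classified_def)
  fix \<beta> assume "invariance_eqs a b c \<beta>"
  then have "classified (a, b, d) (a + b + d + 4) (moment_op (dual_moments \<beta>))"
    using assms invariance_eqs_dual[OF _ d] unfolding all_classified_def by blast
  moreover have "perm_or_dual ((a, b, c), a + b + c + 4, moment_op \<beta>)
     ((a, b, 1 - (a + b + c + 4)), 1 - c, moment_op (dual_moments \<beta>))"
    unfolding adjoint3_moment_op[symmetric] moment_op_def[of \<beta>] by (rule perm_or_dual.dual3)
  moreover have "1 - (a + b + c + 4) = d" "1 - c = a + b + d + 4"
    using d by simp_all
  ultimately show "classified (a, b, c) (a + b + c + 4) (moment_op \<beta>)"
    by (simp only: classified_step)
qed (use assms in \<open>simp add: all_classified_def\<close>)

lemma all_classified_swap13: "all_classified c b a d \<Longrightarrow> all_classified a b c d"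
  by (rule all_classified_swap12, rule all_classified_swap23, rule all_classified_swap12)

lemma all_classified_swap24: "all_classified a d c b \<Longrightarrow> all_classified a b c d"
  by (rule all_classified_swap23, rule all_classified_swap34, rule all_classified_swap23)

lemma all_classified_swap14: "all_classified d b c a \<Longrightarrow> all_classified a b c d"
  by (rule all_classified_swap12, rule all_classified_swap24, rule all_classified_swap12)

section \<open>Reduction to the moments without derivatives of the third argument\<close>

text \<open>
Eliminating the moments with \<open>l > 0\<close>.  Each equation at an index with \<open>l > 0\<close> is multiplied by \<open>c\<close>, and
then the equations at the indices \<open>(p, i, j, 0)\<close>, in which \<open>c * \<beta> i j (p - 1)\<close> occurs, replace every
moment by moments of the form \<open>\<beta> i j 0\<close>.
\<close>

lemma binary_part_relations:
  assumes "invariance_eqs a b c \<beta>"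
  shows "b * (4*b + 4*c + 7) * \<beta> 0 4 0 + 4*a*b * (\<beta> 1 3 0 + \<beta> 3 1 0) + a * (4*a + 4*c + 7) * \<beta> 4 0 0 = 0"
    and "b * (3*b + 3*c + 4) * \<beta> 0 4 0 + 6*a*b * \<beta> 2 2 0 + a * (3*a + 3*c + 4) * \<beta> 4 0 0 = 0"
    and "(3*(2+2*b)*(3+2*b) + 2*(1+2*c)*(2+3*b)) * \<beta> 0 4 0 + 24*a*(1+b) * \<beta> 1 3 0
           + 12*a*(1+a+c) * \<beta> 2 2 0 = 0"
    and "(3*(1+2*b)*(2+2*b) + 2*(1+2*c)*(1+3*b)) * \<beta> 1 3 0 + 6*(1+2*a)*(1+2*b) * \<beta> 2 2 0
           + (3*(1+2*a)*(2+2*a) + 2*(1+2*c)*(1+3*a)) * \<beta> 3 1 0 = 0"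
    and "(2*(1+2*b)*(2+3*b) + 3*(1+c)*(1+4*b)) * \<beta> 0 4 0 + 4*a*(1+3*b) * \<beta> 1 3 0
           + 6*a*(1+2*b) * \<beta> 2 2 0 + 4*a*(3*a+3*c+4) * \<beta> 3 1 0 = 0"
    and "(2*(1+2*a)*(2+3*a) + 3*(1+c)*(1+4*a)) * \<beta> 4 0 0 + 4*b*(1+3*a) * \<beta> 3 1 0
           + 6*b*(1+2*a) * \<beta> 2 2 0 + 4*b*(3*b+3*c+4) * \<beta> 1 3 0 = 0"
proof -
  note e = invariance_eqsD[OF assms]
  show "b * (4*b + 4*c + 7) * \<beta> 0 4 0 + 4*a*b * (\<beta> 1 3 0 + \<beta> 3 1 0) + a * (4*a + 4*c + 7) * \<beta> 4 0 0 = 0"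
    using e(10,17,18,20) by algebra
  show "b * (3*b + 3*c + 4) * \<beta> 0 4 0 + 6*a*b * \<beta> 2 2 0 + a * (3*a + 3*c + 4) * \<beta> 4 0 0 = 0"
    using e(16,11,14,20) by algebra
  show "(3*(2+2*b)*(3+2*b) + 2*(1+2*c)*(2+3*b)) * \<beta> 0 4 0 + 24*a*(1+b) * \<beta> 1 3 0
           + 12*a*(1+a+c) * \<beta> 2 2 0 = 0"
    using e(8,4,7,14) by algebra
  show "(3*(1+2*b)*(2+2*b) + 2*(1+2*c)*(1+3*b)) * \<beta> 1 3 0 + 6*(1+2*a)*(1+2*b) * \<beta> 2 2 0
           + (3*(1+2*a)*(2+2*a) + 2*(1+2*c)*(1+3*a)) * \<beta> 3 1 0 = 0"
    using e(5,2,4,12) by algebra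
  show "(2*(1+2*b)*(2+3*b) + 3*(1+c)*(1+4*b)) * \<beta> 0 4 0 + 4*a*(1+3*b) * \<beta> 1 3 0
           + 6*a*(1+2*b) * \<beta> 2 2 0 + 4*a*(3*a+3*c+4) * \<beta> 3 1 0 = 0"
    using e(9,12,14,18) by algebra
  show "(2*(1+2*a)*(2+3*a) + 3*(1+c)*(1+4*a)) * \<beta> 4 0 0 + 4*b*(1+3*a) * \<beta> 3 1 0
           + 6*b*(1+2*a) * \<beta> 2 2 0 + 4*b*(3*b+3*c+4) * \<beta> 1 3 0 = 0"
    using e(6,12,11,17) by algebra
qed

text \<open>
These are the equations with \<open>l = 0\<close>, solved for the moment multiplied by \<open>c\<close>.
\<close>

lemma moments_from_binary_part:
  assumes "invariance_eqs a b c \<beta>" and "c \<noteq> 0"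
  shows "\<beta> 3 0 1 = - ((3 + 2 * a) * \<beta> 4 0 0 + 2 * b * \<beta> 3 1 0) / (2 * c)"
    "\<beta> 2 1 1 = - ((2 + 2 * a) * \<beta> 3 1 0 + (1 + 2 * b) * \<beta> 2 2 0) / (2 * c)"
    "\<beta> 1 2 1 = - ((1 + 2 * a) * \<beta> 2 2 0 + (2 + 2 * b) * \<beta> 1 3 0) / (2 * c)"
    "\<beta> 0 3 1 = - (2 * a * \<beta> 1 3 0 + (3 + 2 * b) * \<beta> 0 4 0) / (2 * c)"
    "\<beta> 2 0 2 = - ((2 + 3 * a) * \<beta> 4 0 0 + 3 * b * \<beta> 2 2 0) / (3 * c)"
    "\<beta> 1 1 2 = - ((1 + 3 * a) * \<beta> 3 1 0 + (1 + 3 * b) * \<beta> 1 3 0) / (3 * c)"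
    "\<beta> 0 2 2 = - (3 * a * \<beta> 2 2 0 + (2 + 3 * b) * \<beta> 0 4 0) / (3 * c)"
    "\<beta> 1 0 3 = - ((1 + 4 * a) * \<beta> 4 0 0 + 4 * b * \<beta> 1 3 0) / (4 * c)"
    "\<beta> 0 1 3 = - (4 * a * \<beta> 3 1 0 + (1 + 4 * b) * \<beta> 0 4 0) / (4 * c)"
    "\<beta> 0 0 4 = - (a * \<beta> 4 0 0 + b * \<beta> 0 4 0) / c"
proof -
  note e = invariance_eqsD[OF assms(1)]
  have solve: "r * t + s = 0 \<Longrightarrow> r \<noteq> 0 \<Longrightarrow> t = - s / r" for r s t :: real
    by (simp add: field_simps add_eq_0_iff)
  show "\<beta> 3 0 1 = - ((3 + 2 * a) * \<beta> 4 0 0 + 2 * b * \<beta> 3 1 0) / (2 * c)"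
    by (rule solve) (use e(1) assms(2) in \<open>simp_all add: algebra_simps\<close>)
  show "\<beta> 2 1 1 = - ((2 + 2 * a) * \<beta> 3 1 0 + (1 + 2 * b) * \<beta> 2 2 0) / (2 * c)"
    by (rule solve) (use e(2) assms(2) in \<open>simp_all add: algebra_simps\<close>)
  show "\<beta> 1 2 1 = - ((1 + 2 * a) * \<beta> 2 2 0 + (2 + 2 * b) * \<beta> 1 3 0) / (2 * c)"
    by (rule solve) (use e(4) assms(2) in \<open>simp_all add: algebra_simps\<close>)
  show "\<beta> 0 3 1 = - (2 * a * \<beta> 1 3 0 + (3 + 2 * b) * \<beta> 0 4 0) / (2 * c)"
    by (rule solve) (use e(7) assms(2) in \<open>simp_all add: algebra_simps\<close>)
  show "\<beta> 2 0 2 = - ((2 + 3 * a) * \<beta> 4 0 0 + 3 * b * \<beta> 2 2 0) / (3 * c)"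
    by (rule solve) (use e(11) assms(2) in \<open>simp_all add: algebra_simps\<close>)
  show "\<beta> 1 1 2 = - ((1 + 3 * a) * \<beta> 3 1 0 + (1 + 3 * b) * \<beta> 1 3 0) / (3 * c)"
    by (rule solve) (use e(12) assms(2) in \<open>simp_all add: algebra_simps\<close>)
  show "\<beta> 0 2 2 = - (3 * a * \<beta> 2 2 0 + (2 + 3 * b) * \<beta> 0 4 0) / (3 * c)"
    by (rule solve) (use e(14) assms(2) in \<open>simp_all add: algebra_simps\<close>)
  show "\<beta> 1 0 3 = - ((1 + 4 * a) * \<beta> 4 0 0 + 4 * b * \<beta> 1 3 0) / (4 * c)"
    by (rule solve) (use e(17) assms(2) in \<open>simp_all add: algebra_simps\<close>)
  show "\<beta> 0 1 3 = - (4 * a * \<beta> 3 1 0 + (1 + 4 * b) * \<beta> 0 4 0) / (4 * c)"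
    by (rule solve) (use e(18) assms(2) in \<open>simp_all add: algebra_simps\<close>)
  show "\<beta> 0 0 4 = - (a * \<beta> 4 0 0 + b * \<beta> 0 4 0) / c"
    by (rule solve) (use e(20) assms(2) in \<open>simp_all add: algebra_simps\<close>)
qed

text \<open>
In the equation with \<open>p = l + 1\<close> at the index \<open>(i, j, 0)\<close> the moment \<open>\<beta> i j l\<close> has the coefficient \<open>(l + 1) c\<close>,
and the other two moments have third index 0.
\<close>

lemma vanishes_if_binary_part_vanishes:
  assumes eqs: "invariance_eqs a b c \<beta>" and c: "c \<noteq> 0"
    and binary: "\<And>i j. i + j = 4 \<Longrightarrow> \<beta> i j 0 = 0" and sum: "i + j + l = 4"
  shows "\<beta> i j l = 0"
proof (cases "l = 0")
  case True
  then show ?thesis using binary sum by simp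
next
  case False
  have "(i + (l + 1) * a) * \<beta> (i + (l + 1) - 1) j 0 + (j + (l + 1) * b) * \<beta> i (j + (l + 1) - 1) 0
       + (0 + (l + 1) * c) * \<beta> i j (0 + (l + 1) - 1) = 0"
    using eqs[unfolded invariance_eqs_def, rule_format, of "l + 1" i j 0] False sum by simp
  moreover have "\<beta> (i + (l + 1) - 1) j 0 = 0" "\<beta> i (j + (l + 1) - 1) 0 = 0"
    using binary sum by simp_all
  ultimately show ?thesis using c by (simp add: add_eq_0_iff)
qed

section \<open>Weights without zero\<close>

text \<open>
The first two relations between the moments \<open>\<beta> i j 0\<close> have \<open>b\<close> and \<open>a\<close> as factors of their extreme terms
and \<open>a b\<close> as factor of the middle ones.  The substitution \<open>\<beta> 0 4 0 = a v\<close>, \<open>\<beta> 4 0 0 = b w\<close> therefore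
makes a division by \<open>a b\<close> possible, and in the end the five moments are linear in \<open>v\<close> and \<open>w\<close>.
\<close>

lemma nonzero_weights_solution:
  assumes eqs: "invariance_eqs a b c \<beta>" and d: "d = -3 - a - b - c"
    and nz: "a \<noteq> 0" "b \<noteq> 0" "c \<noteq> 0" "d \<noteq> 0"
  obtains v w where
    "\<beta> 0 4 0 = a * v" "\<beta> 4 0 0 = b * w"
    "\<beta> 1 3 0 = - ((4*b + 4*c + 7) * v + (4*a + 4*c + 7) * w) / 8 - 5 * (v - w) / 24"
    "\<beta> 2 2 0 = - ((3*b + 3*c + 4) * v + (3*a + 3*c + 4) * w) / 6"
    "\<beta> 3 1 0 = - ((4*b + 4*c + 7) * v + (4*a + 4*c + 7) * w) / 8 + 5 * (v - w) / 24"
    "((3*a+3*c+4) * (3*b+3*c+4) + 3*c+2) * v + 3 * (3*a+3*c+4) * (b - d) * w = 0"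
    "((3*a+3*c+4) * (3*b+3*c+4) + 3*c+2) * w + 3 * (3*b+3*c+4) * (a - d) * v = 0"
    "((3*a+3*c+4) * (3*b+3*c+4) + 3*c+2) * (v + w) = 0"
proof -
  define v where "v = \<beta> 0 4 0 / a"
  define w where "w = \<beta> 4 0 0 / b"
  have u0: "\<beta> 0 4 0 = a * v" and u4: "\<beta> 4 0 0 = b * w"
    using nz by (simp_all add: v_def w_def)
  note rel = binary_part_relations[OF eqs, unfolded u0 u4]
  have "a * b * ((4*b + 4*c + 7) * v + 4 * (\<beta> 1 3 0 + \<beta> 3 1 0) + (4*a + 4*c + 7) * w) = 0"
    using rel(1) by algebra
  then have X: "4 * (\<beta> 1 3 0 + \<beta> 3 1 0) = - ((4*b + 4*c + 7) * v + (4*a + 4*c + 7) * w)"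
    using nz by simp
  have "a * b * ((3*b + 3*c + 4) * v + 6 * \<beta> 2 2 0 + (3*a + 3*c + 4) * w) = 0"
    using rel(2) by algebra
  then have Y: "6 * \<beta> 2 2 0 = - ((3*b + 3*c + 4) * v + (3*a + 3*c + 4) * w)"
    using nz by simp
  \<comment> \<open>The combination of the third and fifth relation in which the terms of degree 2 in the weights
     cancel; a factor \<open>d\<close> splits off.\<close>
  have "a * d * (5 * (v - w) + 12 * (\<beta> 1 3 0 - \<beta> 3 1 0)) = 0"
    using rel(3,5) X Y d by algebra
  then have S: "12 * (\<beta> 1 3 0 - \<beta> 3 1 0) = - 5 * (v - w)"
    using nz by simp
  have u: "\<beta> 1 3 0 = - ((4*b + 4*c + 7) * v + (4*a + 4*c + 7) * w) / 8 - 5 * (v - w) / 24"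
    "\<beta> 2 2 0 = - ((3*b + 3*c + 4) * v + (3*a + 3*c + 4) * w) / 6"
    "\<beta> 3 1 0 = - ((4*b + 4*c + 7) * v + (4*a + 4*c + 7) * w) / 8 + 5 * (v - w) / 24"
    using X Y S by (simp_all add: field_simps)
  define q where "q = (3*a+3*c+4) * (3*b+3*c+4) + 3*c+2"
  have "a * (q * v + 3 * (3*a+3*c+4) * (b - d) * w) = 0"
    using rel(5) unfolding u q_def d by (simp add: field_simps)
  then have D: "q * v + 3 * (3*a+3*c+4) * (b - d) * w = 0"
    using nz by simp
  have "b * (q * w + 3 * (3*b+3*c+4) * (a - d) * v) = 0"
    using rel(6) unfolding u q_def d by (simp add: field_simps)
  then have E: "q * w + 3 * (3*b+3*c+4) * (a - d) * v = 0"
    using nz by simp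
  \<comment> \<open>Modulo the two equations just found, the fourth relation is a multiple of \<open>d q (v + w)\<close>.\<close>
  have "d * (q * (v + w)) = 0"
    using rel(4) D E X Y S unfolding q_def d by algebra
  then have "q * (v + w) = 0"
    using nz by simp
  with u0 u4 u D E show thesis unfolding q_def by (rule that)
qed

text \<open>
With \<open>q = (x + z) (y + z) + z\<close> the last equation leaves the cases \<open>q = 0\<close> and \<open>u = - v\<close>.  If \<open>q \<noteq> 0\<close>,
comparing the first two equations gives \<open>(x - y) (z + w) = 0\<close>; if \<open>q = 0\<close>, they become monomial and
one of \<open>(y + z) (x - w)\<close>, \<open>(x + z) (y - w)\<close> vanishes.  Once two of the numbers are equal, \<open>q\<close> (or its
difference with the other coefficient) splits into linear factors because the sum is \<open>-1\<close>.
\<close>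

lemma equal_pairs_or_grozman_pair:
  fixes x y z w u v :: real
  assumes sum: "x + y + z + w = -1"
    and "((x+z) * (y+z) + z) * u + (x+z) * (y-w) * v = 0"
    and "((x+z) * (y+z) + z) * v + (y+z) * (x-w) * u = 0"
    and "((x+z) * (y+z) + z) * (u + v) = 0"
    and "u \<noteq> 0 \<or> v \<noteq> 0"
  shows "(x = 0 \<and> y = 0) \<or> (x = 0 \<and> z = 0) \<or> (x = 0 \<and> w = 0) \<or> (y = 0 \<and> z = 0) \<or> (y = 0 \<and> w = 0)
    \<or> (z = 0 \<and> w = 0) \<or> (x = y \<and> z = w) \<or> (x = z \<and> y = w) \<or> (x = w \<and> y = z)"
proof -
  have w: "w = -1 - x - y - z" using sum by simp
  consider (A) "(x+z) * (y+z) + z \<noteq> 0" | (B) "(x+z) * (y+z) + z = 0" "u \<noteq> 0" 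
    | (C) "(x+z) * (y+z) + z = 0" "v \<noteq> 0" using assms(5) by blast
  then show ?thesis
  proof cases
    case A
    then have "u = - v" "v \<noteq> 0" using assms(4,5) by auto
    have "v * ((x+z) * (y+z) + z - (x+z) * (y-w)) = 0"
      using assms(2) unfolding \<open>u = - v\<close> by algebra
    moreover have "v * ((x+z) * (y+z) + z - (y+z) * (x-w)) = 0"
      using assms(3) unfolding \<open>u = - v\<close> by algebra
    ultimately have e: "(x+z) * (y+z) + z - (x+z) * (y-w) = 0" "(x+z) * (y+z) + z - (y+z) * (x-w) = 0"
      using \<open>v \<noteq> 0\<close> by auto
    have "(x - y) * (z + w) = 0" using e by algebra
    then have "x - y = 0 \<or> z + w = 0" by simp
    then show ?thesis
    proof
      assume "x - y = 0"
      then have y: "y = x" by simp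
      have "x * (1 + 2 * x + 2 * z) = 0" using e(1) unfolding w y by algebra
      then have "x = 0 \<or> z = - 1/2 - x" by auto
      then show ?thesis using w y by force
    next
      assume zw: "z + w = 0"
      have "z = (x+z) * (- (z + w))" using e(1) by algebra
      then show ?thesis using zw by simp
    qed
  next
    case B
    then have "y + z = 0 \<or> x - w = 0" using assms(3) by simp
    then show ?thesis
    proof
      assume "y + z = 0"
      then show ?thesis using B by simp
    next
      assume "x - w = 0"
      then have y: "y = -1 - 2 * x - z" using w by simp
      have "x * (1 + 2 * x + 2 * z) = 0" using B(1) unfolding y by algebra
      then have "x = 0 \<or> z = - 1/2 - x" by auto
      then show ?thesis using \<open>x - w = 0\<close> y by force
    qed
  next
    case C
    then have "x + z = 0 \<or> y - w = 0" using assms(2) by simp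
    then show ?thesis
    proof
      assume "x + z = 0"
      then show ?thesis using C by simp
    next
      assume "y - w = 0"
      then have x: "x = -1 - 2 * y - z" using w by simp
      have "y * (1 + 2 * y + 2 * z) = 0" using C(1) unfolding x by algebra
      then have "y = 0 \<or> z = - 1/2 - y" by auto
      then show ?thesis using \<open>y - w = 0\<close> x by force
    qed
  qed
qed

text \<open>
A solution with \<open>v = w = 0\<close> is zero.  Otherwise the three equations for \<open>v\<close> and \<open>w\<close>, written in the shifted
weights \<open>x = 3 a + 2\<close> and so on, have the form treated above, and \<open>x = 0\<close> means \<open>a = -2/3\<close>.
\<close>

lemma weights_without_zero:
  assumes eqs: "invariance_eqs a b c \<beta>" and d: "d = -3 - a - b - c"
    and nz: "a \<noteq> 0" "b \<noteq> 0" "c \<noteq> 0" "d \<noteq> 0"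
    and \<beta>: "i + j + l = 4" "\<beta> i j l \<noteq> 0"
  shows "a = -2/3 \<and> b = -2/3 \<or> a = -2/3 \<and> c = -2/3 \<or> a = -2/3 \<and> d = -2/3 \<or>
    b = -2/3 \<and> c = -2/3 \<or> b = -2/3 \<and> d = -2/3 \<or> c = -2/3 \<and> d = -2/3 \<or>
    a = b \<and> c = d \<or> a = c \<and> b = d \<or> a = d \<and> b = c"
proof -
  obtain v w where u: "\<beta> 0 4 0 = a * v" "\<beta> 4 0 0 = b * w"
    "\<beta> 1 3 0 = - ((4*b + 4*c + 7) * v + (4*a + 4*c + 7) * w) / 8 - 5 * (v - w) / 24"
    "\<beta> 2 2 0 = - ((3*b + 3*c + 4) * v + (3*a + 3*c + 4) * w) / 6"
    "\<beta> 3 1 0 = - ((4*b + 4*c + 7) * v + (4*a + 4*c + 7) * w) / 8 + 5 * (v - w) / 24"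
    and q: "((3*a+3*c+4) * (3*b+3*c+4) + 3*c+2) * v + 3 * (3*a+3*c+4) * (b - d) * w = 0"
    "((3*a+3*c+4) * (3*b+3*c+4) + 3*c+2) * w + 3 * (3*b+3*c+4) * (a - d) * v = 0"
    "((3*a+3*c+4) * (3*b+3*c+4) + 3*c+2) * (v + w) = 0"
    by (rule nonzero_weights_solution[OF eqs d nz])
  have vw: "v \<noteq> 0 \<or> w \<noteq> 0"
  proof (rule ccontr)
    assume "\<not> (v \<noteq> 0 \<or> w \<noteq> 0)"
    then have "\<beta> 4 0 0 = 0" "\<beta> 3 1 0 = 0" "\<beta> 2 2 0 = 0" "\<beta> 1 3 0 = 0" "\<beta> 0 4 0 = 0"
      unfolding u by simp_all
    moreover have "(i, j) \<in> {(4, 0), (3, 1), (2, 2), (1, 3), (0, 4)}" if "i + j = 4" for i j :: nat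
      using that by (auto simp: eval_nat_numeral add_eq_if split: if_splits)
    ultimately have "\<beta> i j 0 = 0" if "i + j = 4" for i j
      using that by fastforce
    then show False
      using vanishes_if_binary_part_vanishes[OF eqs nz(3) _ \<beta>(1)] \<beta>(2) by blast
  qed
  define x y z t where "x = 3*a+2" and "y = 3*b+2" and "z = 3*c+2" and "t = 3*d+2"
  note xyzt = x_def y_def z_def t_def
  have "x + y + z + t = -1" unfolding xyzt d by simp
  moreover have "((x+z) * (y+z) + z) * v + (x+z) * (y-t) * w = 0"
    using q(1) unfolding xyzt by algebra
  moreover have "((x+z) * (y+z) + z) * w + (y+z) * (x-t) * v = 0"
    using q(2) unfolding xyzt by algebra
  moreover have "((x+z) * (y+z) + z) * (v + w) = 0"
    using q(3) unfolding xyzt by algebra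
  ultimately have "(x = 0 \<and> y = 0) \<or> (x = 0 \<and> z = 0) \<or> (x = 0 \<and> t = 0) \<or> (y = 0 \<and> z = 0) \<or> (y = 0 \<and> t = 0)
    \<or> (z = 0 \<and> t = 0) \<or> (x = y \<and> z = t) \<or> (x = z \<and> y = t) \<or> (x = t \<and> y = z)"
    using vw by (rule equal_pairs_or_grozman_pair)
  then show ?thesis unfolding xyzt by argo
qed

text \<open>
Here \<open>q = (3 c + 2) (3 c + 3)\<close>, which is nonzero as neither \<open>c\<close> nor \<open>d = -5/3 - c\<close> is \<open>-2/3\<close>.  So
\<open>v = - w\<close> and the space of solutions is a line.
\<close>

lemma all_classified_grozman:
  assumes "c + d = -5/3" "c \<noteq> 0" "d \<noteq> 0" "c \<noteq> -2/3" "d \<noteq> -2/3"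
  shows "all_classified (-2/3) (-2/3) c d"
  unfolding all_classified_def
proof (intro conjI allI impI)
  fix \<beta> assume eqs: "invariance_eqs (-2/3) (-2/3) c \<beta>"
  have d: "d = -3 - (-2/3) - (-2/3) - c" using assms(1) by simp
  obtain v w where u: "\<beta> 0 4 0 = -2/3 * v" "\<beta> 4 0 0 = -2/3 * w"
    "\<beta> 1 3 0 = - ((4*(-2/3) + 4*c + 7) * v + (4*(-2/3) + 4*c + 7) * w) / 8 - 5 * (v - w) / 24"
    "\<beta> 2 2 0 = - ((3*(-2/3) + 3*c + 4) * v + (3*(-2/3) + 3*c + 4) * w) / 6"
    "\<beta> 3 1 0 = - ((4*(-2/3) + 4*c + 7) * v + (4*(-2/3) + 4*c + 7) * w) / 8 + 5 * (v - w) / 24"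
    and vw: "((3*(-2/3)+3*c+4) * (3*(-2/3)+3*c+4) + 3*c+2) * (v + w) = 0"
    by (rule nonzero_weights_solution[OF eqs d]) (use assms in simp_all)
  have "(3*c+2) * (3*c+3) * (v + w) = 0"
    using vw by algebra
  moreover have "3*c+2 \<noteq> 0" "3*c+3 \<noteq> 0"
    using assms by auto
  ultimately have v: "v = - w" by auto
  note \<beta> = moments_from_binary_part[OF eqs assms(2), unfolded u v] u[unfolded v]
  \<comment> \<open>The coefficient of \<open>\<phi>\<^sup>(\<^sup>4\<^sup>) \<psi> \<chi>\<close> in the bracket is \<open>2 c\<close>, so \<open>- 2/3 w = \<beta> 4 0 0\<close> has to be \<open>24 * 2 c k\<close>.\<close>
  define k where "k = - w / (72 * c)"
  have k: "w = - 72 * c * k" using assms(2) by (simp add: k_def)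
  define B where "B = (\<lambda>(\<phi>, \<psi>, \<chi>). poisson (5/3) c (grozman \<phi> \<psi>) \<chi>)"
  have "canonical (-2/3) (-2/3) c B"
    unfolding canonical_def B_def using assms by auto
  moreover have "moment_op \<beta> (\<phi>, \<psi>, \<chi>) = smult k (B (\<phi>, \<psi>, \<chi>))" for \<phi> \<psi> \<chi>
    unfolding moment_op_expand \<beta> B_def prod.case poly_eq_poly_eq_iff[symmetric] k
    using assms(2)
    by (intro ext) (simp add: poisson_def grozman_def pderivs field_simps)
  ultimately show "classified (-2/3, -2/3, c) (-2/3 + -2/3 + c + 4) (moment_op \<beta>)"
    by (rule classifiedI)
qed (use assms in simp)

text \<open>
With \<open>a + c = -3/2\<close> the coefficient of \<open>v\<close> in the first equation of \<open>nonzero_weights_solution\<close> is zero and the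
one of \<open>w\<close> is a multiple of \<open>c - a\<close>.  So \<open>w = 0\<close>, in agreement with the absence of \<open>\<phi>\<^sup>(\<^sup>4\<^sup>)\<close> in \<open>\<Xi>\<close>.
\<close>

lemma all_classified_two_pairs:
  assumes "a + c = -3/2" "a \<noteq> 0" "c \<noteq> 0" "c \<noteq> -2/3" "a \<noteq> c"
  shows "all_classified a c c a"
  unfolding all_classified_def
proof (intro conjI allI impI)
  fix \<beta> assume eqs: "invariance_eqs a c c \<beta>"
  have a: "a = -3/2 - c" using assms(1) by simp
  obtain v w where u: "\<beta> 0 4 0 = a * v" "\<beta> 4 0 0 = c * w"
    "\<beta> 1 3 0 = - ((4*c + 4*c + 7) * v + (4*a + 4*c + 7) * w) / 8 - 5 * (v - w) / 24"
    "\<beta> 2 2 0 = - ((3*c + 3*c + 4) * v + (3*a + 3*c + 4) * w) / 6"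
    "\<beta> 3 1 0 = - ((4*c + 4*c + 7) * v + (4*a + 4*c + 7) * w) / 8 + 5 * (v - w) / 24"
    and vw: "((3*a+3*c+4) * (3*c+3*c+4) + 3*c+2) * v + 3 * (3*a+3*c+4) * (c - a) * w = 0"
    by (rule nonzero_weights_solution[OF eqs, of a]) (use assms in simp_all)
  have "(c - a) * w = 0"
    using vw unfolding a by algebra
  then have w: "w = 0" using assms by simp
  note \<beta> = moments_from_binary_part[OF eqs assms(3), unfolded u w] u[unfolded w]
  \<comment> \<open>The coefficient of \<open>\<phi> \<psi>\<^sup>(\<^sup>4\<^sup>) \<chi>\<close> in \<open>\<Xi>\<close> is \<open>- c (3 + 2 c) = 2 a c\<close>, so \<open>a v = \<beta> 0 4 0\<close> has to be \<open>24 * 2 a c k\<close>.\<close>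
  define k where "k = v / (48 * c)"
  have k: "v = 48 * c * k" using assms(3) by (simp add: k_def)
  have "c \<noteq> -3/2" "c \<noteq> -3/4" using assms by auto
  then have "canonical a c c (Xi c)"
    unfolding canonical_def using assms a by auto
  moreover have "moment_op \<beta> (\<phi>, \<psi>, \<chi>) = smult k (Xi c (\<phi>, \<psi>, \<chi>))" for \<phi> \<psi> \<chi>
    unfolding moment_op_expand \<beta> poly_eq_poly_eq_iff[symmetric] k
    using assms(3)
    by (intro ext) (simp add: Xi_def jet_def a field_simps)
  ultimately show "classified (a, c, c) (a + c + c + 4) (moment_op \<beta>)"
    by (rule classifiedI)
qed (use assms in simp)

text \<open>
Three weights \<open>-2/3\<close>: the equations have a two-dimensional space of solutions, with coordinates
\<open>\<beta> 4 0 0\<close> and \<open>\<beta> 1 3 0\<close>.  The formulas for \<open>\<epsilon>1\<close> and \<open>\<epsilon>2\<close> come from comparing these two moments with those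
of the two compositions.
\<close>

lemma all_classified_double_grozman: "all_classified (-1) (-2/3) (-2/3) (-2/3)"
  unfolding all_classified_def
proof (intro conjI allI impI)
  fix \<beta> assume "invariance_eqs (-1) (-2/3) (-2/3) \<beta>"
  note e = invariance_eqsD[OF this]
  have \<beta>:
    "\<beta> 3 1 0 = 3/8 * \<beta> 4 0 0" "\<beta> 3 0 1 = 3/8 * \<beta> 4 0 0"
    "\<beta> 2 2 0 = -1/4 * \<beta> 4 0 0" "\<beta> 2 1 1 = 1/16 * \<beta> 4 0 0"
    "\<beta> 2 0 2 = -1/4 * \<beta> 4 0 0"
    "\<beta> 1 2 1 = 3/16 * \<beta> 4 0 0 + 1/2 * \<beta> 1 3 0"
    "\<beta> 1 1 2 = -3/8 * \<beta> 4 0 0 + -1/2 * \<beta> 1 3 0"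
    "\<beta> 1 0 3 = -9/8 * \<beta> 4 0 0 + -\<beta> 1 3 0"
    "\<beta> 0 4 0 = 3/5 * \<beta> 4 0 0 + 12/5 * \<beta> 1 3 0"
    "\<beta> 0 3 1 = 3/4 * \<beta> 4 0 0 + 3/2 * \<beta> 1 3 0"
    "\<beta> 0 2 2 = 3/8 * \<beta> 4 0 0"
    "\<beta> 0 1 3 = -15/16 * \<beta> 4 0 0 + -3/2 * \<beta> 1 3 0"
    "\<beta> 0 0 4 = -21/10 * \<beta> 4 0 0 + -12/5 * \<beta> 1 3 0"
    using e by algebra+
  define \<epsilon>1 where "\<epsilon>1 = 1/80 * \<beta> 4 0 0 + 1/20 * \<beta> 1 3 0"
  define \<epsilon>2 where "\<epsilon>2 = -7/160 * \<beta> 4 0 0 + -1/20 * \<beta> 1 3 0"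
  define B where "B = (\<lambda>(\<phi>, \<psi>, \<chi>). smult \<epsilon>1 (grozman (poisson (-1) (-2/3) \<phi> \<psi>) \<chi>)
         + smult \<epsilon>2 (grozman (poisson (-1) (-2/3) \<phi> \<chi>) \<psi>))"
  have "canonical (-1) (-2/3) (-2/3) B"
    unfolding canonical_def B_def by auto
  moreover have "moment_op \<beta> (\<phi>, \<psi>, \<chi>) = smult 1 (B (\<phi>, \<psi>, \<chi>))" for \<phi> \<psi> \<chi>
    unfolding moment_op_expand \<beta> B_def prod.case poly_eq_poly_eq_iff[symmetric] \<epsilon>1_def \<epsilon>2_def
    by (rule ext) (simp add: poisson_def grozman_def de_rham_def pderivs field_simps)
  ultimately show "classified ((-1), (-2/3), (-2/3)) ((-1) + (-2/3) + (-2/3) + 4) (moment_op \<beta>)"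
    by (rule classifiedI)
qed simp

text \<open>
Again a two-dimensional space of solutions; \<open>\<epsilon>1\<close> and \<open>\<epsilon>2\<close>, the parameters \<open>s\<close> and \<open>t\<close>, are read off from
\<open>\<beta> 4 0 0 = 24 t\<close> and \<open>\<beta> 3 1 0 = 8/3 (4 t - s)\<close>.
\<close>

lemma all_classified_equal_weights: "all_classified (-3/4) (-3/4) (-3/4) (-3/4)"
  unfolding all_classified_def
proof (intro conjI allI impI)
  fix \<beta> assume "invariance_eqs (-3/4) (-3/4) (-3/4) \<beta>"
  note e = invariance_eqsD[OF this]
  have \<beta>:
    "\<beta> 3 0 1 = \<beta> 4 0 0 + -\<beta> 3 1 0"
    "\<beta> 2 2 0 = -5/9 * \<beta> 4 0 0 + \<beta> 3 1 0"
    "\<beta> 2 1 1 = 5/27 * \<beta> 4 0 0"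
    "\<beta> 2 0 2 = 4/9 * \<beta> 4 0 0 + -\<beta> 3 1 0"
    "\<beta> 1 3 0 = 5/3 * \<beta> 4 0 0 + -4 * \<beta> 3 1 0"
    "\<beta> 1 2 1 = 20/27 * \<beta> 4 0 0 + -5/3 * \<beta> 3 1 0"
    "\<beta> 1 1 2 = -25/27 * \<beta> 4 0 0 + 5/3 * \<beta> 3 1 0"
    "\<beta> 1 0 3 = -7/3 * \<beta> 4 0 0 + 4 * \<beta> 3 1 0"
    "\<beta> 0 4 0 = 4 * \<beta> 4 0 0 + -9 * \<beta> 3 1 0"
    "\<beta> 0 3 1 = 7/3 * \<beta> 4 0 0 + -5 * \<beta> 3 1 0"
    "\<beta> 0 2 2 = 1/9 * \<beta> 4 0 0"
    "\<beta> 0 1 3 = -8/3 * \<beta> 4 0 0 + 5 * \<beta> 3 1 0"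
    "\<beta> 0 0 4 = -5 * \<beta> 4 0 0 + 9 * \<beta> 3 1 0"
    using e by algebra+
  define \<epsilon>1 where "\<epsilon>1 = 1/6 * \<beta> 4 0 0 + -3/8 * \<beta> 3 1 0"
  define \<epsilon>2 where "\<epsilon>2 = 1/24 * \<beta> 4 0 0"
  define B where "B = (\<lambda>(\<phi>, \<psi>, \<chi>). Xi_st \<epsilon>1 \<epsilon>2 (\<phi>, \<psi>, \<chi>))"
  have "canonical (-3/4) (-3/4) (-3/4) B"
    unfolding canonical_def B_def by auto
  moreover have "moment_op \<beta> (\<phi>, \<psi>, \<chi>) = smult 1 (B (\<phi>, \<psi>, \<chi>))" for \<phi> \<psi> \<chi>
    unfolding moment_op_expand \<beta> B_def prod.case poly_eq_poly_eq_iff[symmetric] \<epsilon>1_def \<epsilon>2_def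
    by (rule ext) (simp add: Xi_st_def jet_def pderivs field_simps)
  ultimately show "classified ((-3/4), (-3/4), (-3/4)) ((-3/4) + (-3/4) + (-3/4) + 4) (moment_op \<beta>)"
    by (rule classifiedI)
qed simp

lemma all_classified_if_grozman_pair:
  assumes "c + d = -5/3" "c \<noteq> 0" "d \<noteq> 0"
  shows "all_classified (-2/3) (-2/3) c d"
proof -
  consider "c = -2/3" "d = -1" | "c = -1" "d = -2/3" | "c \<noteq> -2/3" "d \<noteq> -2/3"
    using assms(1) by linarith
  then show ?thesis
  proof cases
    case 1
    show ?thesis unfolding 1
      by (rule all_classified_swap14, rule all_classified_double_grozman)
  next
    case 2
    show ?thesis unfolding 2
      by (rule all_classified_swap13, rule all_classified_double_grozman)
  next
    case 3
    then show ?thesis using all_classified_grozman assms by blast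
  qed
qed

text \<open>
The weight \<open>-2/3\<close>, excluded for \<open>\<Xi>\<close>, leads to two weights \<open>-2/3\<close> and thus to the Grozman operator.
\<close>

lemma all_classified_if_two_pairs:
  assumes "a + c = -3/2" "a \<noteq> 0" "c \<noteq> 0"
  shows "all_classified a c c a"
proof -
  consider "a = -3/4" "c = -3/4" | "a = -5/6" "c = -2/3" | "c \<noteq> -2/3" "a \<noteq> c"
    using assms(1) by linarith
  then show ?thesis
  proof cases
    case 1
    show ?thesis unfolding 1 by (rule all_classified_equal_weights)
  next
    case 2
    show ?thesis unfolding 2
      by (rule all_classified_swap13, rule all_classified_if_grozman_pair) simp_all
  next
    case 3
    then show ?thesis using all_classified_two_pairs assms by blast
  qed
qed

lemma all_classified_without_zero:
  assumes sum: "a + b + c + d = -3"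
    and nz: "a \<noteq> 0" "b \<noteq> 0" "c \<noteq> 0" "d \<noteq> 0"
    and weights: "a = -2/3 \<and> b = -2/3 \<or> a = -2/3 \<and> c = -2/3 \<or> a = -2/3 \<and> d = -2/3 \<or>
      b = -2/3 \<and> c = -2/3 \<or> b = -2/3 \<and> d = -2/3 \<or> c = -2/3 \<and> d = -2/3 \<or>
      a = b \<and> c = d \<or> a = c \<and> b = d \<or> a = d \<and> b = c"
  shows "all_classified a b c d"
  using weights
proof (elim disjE conjE)
  assume "a = -2/3" "b = -2/3"
  then show ?thesis
    using sum nz all_classified_if_grozman_pair[of c d] by simp
next
  assume "a = -2/3" "c = -2/3"
  then show ?thesis
    using sum nz all_classified_swap23[OF all_classified_if_grozman_pair[of b d]] by simp
next
  assume "a = -2/3" "d = -2/3"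
  then show ?thesis
    using sum nz all_classified_swap24[OF all_classified_if_grozman_pair[of c b]] by simp
next
  assume "b = -2/3" "c = -2/3"
  then show ?thesis
    using sum nz all_classified_swap13[OF all_classified_if_grozman_pair[of a d]] by simp
next
  assume "b = -2/3" "d = -2/3"
  then show ?thesis
    using sum nz all_classified_swap14[OF all_classified_if_grozman_pair[of c a]] by simp
next
  assume "c = -2/3" "d = -2/3"
  then show ?thesis
    using sum nz all_classified_swap13[OF all_classified_swap24[OF all_classified_if_grozman_pair[of a b]]]
    by simp
next
  assume "a = b" "c = d"
  then show ?thesis
    using sum nz all_classified_swap24[OF all_classified_if_two_pairs[of b d]] by simp
next
  assume "a = c" "b = d"
  then show ?thesis
    using sum nz all_classified_swap34[OF all_classified_if_two_pairs[of c d]] by simp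
next
  assume "a = d" "b = c"
  then show ?thesis
    using sum nz all_classified_if_two_pairs[of d c] by simp
qed

section \<open>Weights with a zero\<close>

text \<open>
The moments with \<open>i = 0\<close> or \<open>j = 0\<close> are those of binary operators of order 4 with weights \<open>(0, c)\<close>, and
they vanish.  The remaining six moments satisfy four independent equations, and \<open>\<beta> 1 1 2\<close>, \<open>\<beta> 2 1 1\<close>
are coordinates on the solutions.
\<close>

lemma all_classified_two_zeros:
  assumes "c + d = -3"
  shows "all_classified 0 0 c d"
  unfolding all_classified_def
proof (intro conjI allI impI)
  fix \<beta> assume eqs: "invariance_eqs 0 0 c \<beta>"
  note e = invariance_eqsD[OF eqs]
  define \<epsilon>2 where "\<epsilon>2 = \<beta> 1 1 2 / 2"
  define \<epsilon>1 where "\<epsilon>1 = ((1 - c) * \<epsilon>2 - \<beta> 2 1 1 / 2) / 3"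
  have z1: "\<beta> 1 0 3 = 0"
    using e(3,6,13,1,17) by algebra
  have z2: "\<beta> 0 1 3 = 0"
    using e(8,9,15,7,18) by algebra
  have z3: "\<beta> 0 0 4 = 0"
    using e(10,16) by algebra
  have \<epsilon>: "\<beta> 1 1 2 = 2 * \<epsilon>2" "\<beta> 2 1 1 = 2 * (-3 * \<epsilon>1 + (1 - c) * \<epsilon>2)"
    unfolding \<epsilon>1_def \<epsilon>2_def by (simp_all add: field_simps)
  have z: "\<beta> 4 0 0 = 0" "\<beta> 0 4 0 = 0" "\<beta> 3 0 1 = 0" "\<beta> 0 3 1 = 0" "\<beta> 2 0 2 = 0" "\<beta> 0 2 2 = 0"
    using z1 z2 z3 e(6,9,13,15,17,18) by simp_all
  have m: "\<beta> 1 2 1 = 2 * (3 * \<epsilon>1 - (c + 2) * \<epsilon>2)"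
    using e(5) \<epsilon> by algebra
  have n: "\<beta> 2 2 0 = 4 * (c * (c + 2) * \<epsilon>2)"
    using e(2,4,12) m \<epsilon> by algebra
  have "\<beta> 3 1 0 = 6 * (c * \<epsilon>1 - c * \<epsilon>2)" "\<beta> 1 3 0 = - 6 * (c * \<epsilon>1)"
    using e(2,4) m n \<epsilon> by algebra+
  note \<beta> = this m n \<epsilon> z z1 z2 z3
  define B where "B = (\<lambda>(\<phi>, \<psi>, \<chi>). smult \<epsilon>1 (poisson 3 c (poisson 1 1 (de_rham \<phi>) (de_rham \<psi>)) \<chi>)
         + smult \<epsilon>2 (poisson (c + 2) 1 (poisson c 1 \<chi> (de_rham \<phi>)) (de_rham \<psi>)))"
  have "canonical 0 0 c B"
    unfolding canonical_def B_def by auto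
  moreover have "moment_op \<beta> (\<phi>, \<psi>, \<chi>) = smult 1 (B (\<phi>, \<psi>, \<chi>))" for \<phi> \<psi> \<chi>
    unfolding moment_op_expand \<beta> B_def prod.case poly_eq_poly_eq_iff[symmetric]
    by (intro ext) (simp add: poisson_def de_rham_def pderivs field_simps)
  ultimately show "classified (0, 0, c) (0 + 0 + c + 4) (moment_op \<beta>)"
    by (rule classifiedI)
qed (use assms in simp)

text \<open>
Because \<open>b = 0\<close>, the equations make every moment with \<open>j = 0\<close> vanish, so that only derivatives of
\<open>\<psi>\<close> occur.  The remaining moments without derivatives of \<open>\<chi>\<close> satisfy three relations, and the three
excluded pairs \<open>(a, c)\<close> are the ones for which the rank of these relations drops.
\<close>

lemma all_classified_one_zero:
  assumes d: "a + c + d = -3" and nz: "a \<noteq> 0" "c \<noteq> 0" "d \<noteq> 0"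
    and special: "\<not> (a = -2 \<and> c = -2)" "\<not> (a = -2 \<and> c = 1)" "\<not> (a = 1 \<and> c = -2)"
  shows "all_classified a 0 c d"
  unfolding all_classified_def
proof (intro conjI allI impI)
  fix \<beta> assume eqs: "invariance_eqs a 0 c \<beta>"
  note rel = binary_part_relations[OF eqs]
  define v where "v = \<beta> 0 4 0 / a"
  have v: "\<beta> 0 4 0 = a * v" using nz by (simp add: v_def)
  have "a * \<beta> 4 0 0 = 0" using rel(1,2) by algebra
  then have u4: "\<beta> 4 0 0 = 0" using nz by simp
  have "a * (12 * \<beta> 1 3 0 + (11 + 4*c) * v + 6 * (a+c+1) * \<beta> 2 2 0) = 0"
    using rel(3) unfolding v by algebra
  then have u1: "12 * \<beta> 1 3 0 = - ((11 + 4*c) * v + 6 * (a+c+1) * \<beta> 2 2 0)"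
    using nz by simp
  have "a * (4 * \<beta> 1 3 0 + (7 + 3*c) * v + 6 * \<beta> 2 2 0 + 4 * (3*a+3*c+4) * \<beta> 3 1 0) = 0"
    using rel(5) unfolding v by algebra
  then have "4 * \<beta> 1 3 0 + (7 + 3*c) * v + 6 * \<beta> 2 2 0 + 4 * (3*a+3*c+4) * \<beta> 3 1 0 = 0"
    using nz by simp
  then have I: "5 * (c+2) * v = 6 * (a+c-2) * \<beta> 2 2 0 - 12 * (3*a+3*c+4) * \<beta> 3 1 0"
    using u1 by algebra
  \<comment> \<open>Eliminating \<open>\<beta> 1 3 0\<close> and \<open>v\<close> from the fourth relation, a factor \<open>d\<close> splits off.\<close>
  have "d * (3 * (1-c) * \<beta> 2 2 0 + 2 * (5*a+4*c+6) * \<beta> 3 1 0) = 0"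
    using rel(4) u1 I d by algebra
  then have II: "3 * (1-c) * \<beta> 2 2 0 + 2 * (5*a+4*c+6) * \<beta> 3 1 0 = 0"
    using nz by simp
  \<comment> \<open>The right-hand sides are the moments of \<open>k \<Delta>\<close>, the last one divided by \<open>a\<close>.  The equations \<open>I\<close> and \<open>II\<close> have rank 2 for
     the weights admitted here, but which of the three unknowns determines \<open>k\<close> depends on \<open>c\<close>.\<close>
  have "\<exists>k. \<beta> 2 2 0 = 4*c*(c+2)*(5*a+4*c+6) * k \<and> \<beta> 3 1 0 = - 6*c*(c+2)*(1-c) * k
     \<and> v = 24*c*(a-c)*(a+c+1) * k"
  proof (cases "c = -2")
    case c: True
    have "(a + 2) * (a - 1) * \<beta> 3 1 0 = 0"
      using I II unfolding c by algebra
    then have u3: "\<beta> 3 1 0 = 0" using special c by auto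
    then have u2: "\<beta> 2 2 0 = 0" using II c by simp
    define k where "k = - v / (48 * ((a + 2) * (a - 1)))"
    have "a + 2 \<noteq> 0" "a - 1 \<noteq> 0"
      using c special by auto
    then have "v = - 48 * ((a + 2) * (a - 1)) * k"
      by (simp add: k_def)
    then have "v = 24*c*(a-c)*(a+c+1) * k"
      unfolding c by algebra
    then show ?thesis
      using u2 u3 c by auto
  next
    case c2: False
    show ?thesis
    proof (cases "c = 1")
      case c: True
      then have a: "a + 2 \<noteq> 0" using special by auto
      then have u3: "\<beta> 3 1 0 = 0" using II c by simp
      define k where "k = \<beta> 2 2 0 / (60 * (a + 2))"
      have u2: "\<beta> 2 2 0 = 60 * (a + 2) * k"
        using a by (simp add: k_def)
      have "15 * (v - 24 * (a - 1) * (a + 2) * k) = 0"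
        using I u3 unfolding c u2 by algebra
      then have "v = 24*c*(a-c)*(a+c+1) * k"
        unfolding c by simp
      moreover have "\<beta> 2 2 0 = 4*c*(c+2)*(5*a+4*c+6) * k"
        unfolding c u2 by algebra
      ultimately show ?thesis
        using u3 c by auto
    next
      case c1: False
      define k where "k = - \<beta> 3 1 0 / (6*c*(c+2)*(1-c))"
      have nz': "c + 2 \<noteq> 0" "1 - c \<noteq> 0" using c1 c2 by auto
      have u3: "\<beta> 3 1 0 = - 6*c*(c+2)*(1-c) * k"
        using nz nz' by (simp add: k_def)
      have "3 * (1-c) * (\<beta> 2 2 0 - 4*c*(c+2)*(5*a+4*c+6) * k) = 0"
        using II unfolding u3 by algebra
      then have u2: "\<beta> 2 2 0 = 4*c*(c+2)*(5*a+4*c+6) * k" using nz' by simp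
      have "5 * (c+2) * (v - 24*c*(a-c)*(a+c+1) * k) = 0"
        using I unfolding u2 u3 by algebra
      then have "v = 24*c*(a-c)*(a+c+1) * k" using nz' by simp
      with u2 u3 show ?thesis by blast
    qed
  qed
  then obtain k where k: "\<beta> 2 2 0 = 4*c*(c+2)*(5*a+4*c+6) * k" "\<beta> 3 1 0 = - 6*c*(c+2)*(1-c) * k"
     "v = 24*c*(a-c)*(a+c+1) * k" by blast
  have "\<beta> 1 3 0 = - ((11 + 4*c) * v + 6 * (a+c+1) * \<beta> 2 2 0) / 12"
    using u1 by simp
  note u = this[unfolded k] k(1,2) v[unfolded k] u4
  note \<beta> = moments_from_binary_part[OF eqs nz(2), unfolded u] u
  define B where "B = (\<lambda>(\<phi>, \<psi>, \<chi>). Delta3 a 1 c (\<phi>, de_rham \<psi>, \<chi>))"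
  have "canonical a 0 c B"
    unfolding canonical_def B_def using nz by auto
  moreover have "moment_op \<beta> (\<phi>, \<psi>, \<chi>) = smult k (B (\<phi>, \<psi>, \<chi>))" for \<phi> \<psi> \<chi>
    unfolding moment_op_expand \<beta> B_def prod.case poly_eq_poly_eq_iff[symmetric]
    using nz(2)
    by (intro ext) (simp add: Delta3_def jet_def de_rham_def pderivs field_simps)
  ultimately show "classified (a, 0, c) (a + 0 + c + 4) (moment_op \<beta>)"
    by (rule classifiedI)
qed (use assms in simp)

text \<open>
The weights for which \<open>\<Delta>\<close> is zero.  The coordinates on the solutions are \<open>\<beta> 3 1 0\<close> and \<open>\<beta> 1 3 0\<close>, and
\<open>\<epsilon>1\<close>, \<open>\<epsilon>2\<close> come from comparing them with the corresponding moments of the two compositions.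
\<close>

lemma all_classified_exceptional_zero: "all_classified (-2) 0 (-2) 1"
  unfolding all_classified_def
proof (intro conjI allI impI)
  fix \<beta> assume "invariance_eqs (-2) 0 (-2) \<beta>"
  note e = invariance_eqsD[OF this]
  have \<beta>:
    "\<beta> 4 0 0 = 0" "\<beta> 3 0 1 = 0" "\<beta> 2 2 0 = 8/3 * \<beta> 3 1 0"
    "\<beta> 2 1 1 = 1/6 * \<beta> 3 1 0" "\<beta> 2 0 2 = 0"
    "\<beta> 1 2 1 = -2 * \<beta> 3 1 0 + 1/2 * \<beta> 1 3 0"
    "\<beta> 1 1 2 = -5/6 * \<beta> 3 1 0 + 1/6 * \<beta> 1 3 0" "\<beta> 1 0 3 = 0"
    "\<beta> 0 4 0 = -32 * \<beta> 3 1 0 + 8 * \<beta> 1 3 0"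
    "\<beta> 0 3 1 = -24 * \<beta> 3 1 0 + 5 * \<beta> 1 3 0"
    "\<beta> 0 2 2 = -40/3 * \<beta> 3 1 0 + 8/3 * \<beta> 1 3 0"
    "\<beta> 0 1 3 = -5 * \<beta> 3 1 0 + \<beta> 1 3 0" "\<beta> 0 0 4 = 0"
    using e by algebra+
  define \<epsilon>1 where "\<epsilon>1 = 1/12 * \<beta> 3 1 0"
  define \<epsilon>2 where "\<epsilon>2 = -5/12 * \<beta> 3 1 0 + 1/12 * \<beta> 1 3 0"
  define B where "B = (\<lambda>(\<phi>, \<psi>, \<chi>). smult \<epsilon>1 (poisson 1 (-2) (de_rham (poisson 1 (-2) (de_rham \<psi>) \<phi>)) \<chi>)
         + smult \<epsilon>2 (poisson 1 (-2) (de_rham (poisson 1 (-2) (de_rham \<psi>) \<chi>)) \<phi>))"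
  have "canonical (-2) 0 (-2) B"
    unfolding canonical_def B_def by auto
  moreover have "moment_op \<beta> (\<phi>, \<psi>, \<chi>) = smult 1 (B (\<phi>, \<psi>, \<chi>))" for \<phi> \<psi> \<chi>
    unfolding moment_op_expand \<beta> B_def prod.case poly_eq_poly_eq_iff[symmetric] \<epsilon>1_def \<epsilon>2_def
    by (rule ext) (simp add: poisson_def grozman_def de_rham_def pderivs field_simps)
  ultimately show "classified (-2, 0, -2) (-2 + 0 + -2 + 4) (moment_op \<beta>)"
    by (rule classifiedI)
qed simp

text \<open>
The three pairs \<open>(a, c)\<close> excluded in \<open>all_classified_one_zero\<close> are the arrangements of the weights
\<open>-2, -2, 1\<close> on \<open>a, c, d\<close>.
\<close>

lemma all_classified_if_one_zero:
  assumes "a + c + d = -3" "a \<noteq> 0" "c \<noteq> 0" "d \<noteq> 0"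
  shows "all_classified a 0 c d"
proof -
  consider "a = -2" "c = -2" "d = 1" | "a = -2" "c = 1" "d = -2" | "a = 1" "c = -2" "d = -2"
    | "\<not> (a = -2 \<and> c = -2)" "\<not> (a = -2 \<and> c = 1)" "\<not> (a = 1 \<and> c = -2)"
    using assms(1) by linarith
  then show ?thesis
  proof cases
    case 1
    show ?thesis unfolding 1 by (rule all_classified_exceptional_zero)
  next
    case 2
    show ?thesis unfolding 2 by (rule all_classified_swap34, rule all_classified_exceptional_zero)
  next
    case 3
    show ?thesis unfolding 3 by (rule all_classified_swap14, rule all_classified_exceptional_zero)
  next
    case 4
    then show ?thesis using all_classified_one_zero assms by blast
  qed
qed

lemma all_classified_if_zero:
  assumes "a + b + c + d = -3" "a = 0 \<or> b = 0 \<or> c = 0 \<or> d = 0"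
  shows "all_classified a b c d"
proof -
  consider (ab) "a = 0" "b = 0" | (ac) "a = 0" "c = 0" | (ad) "a = 0" "d = 0" | (bc) "b = 0" "c = 0"
    | (bd) "b = 0" "d = 0" | (cd) "c = 0" "d = 0"
    | (a) "a = 0" "b \<noteq> 0" "c \<noteq> 0" "d \<noteq> 0" | (b) "a \<noteq> 0" "b = 0" "c \<noteq> 0" "d \<noteq> 0"
    | (c) "a \<noteq> 0" "b \<noteq> 0" "c = 0" "d \<noteq> 0" | (d) "a \<noteq> 0" "b \<noteq> 0" "c \<noteq> 0" "d = 0"
    using assms(2) by blast
  then show ?thesis
  proof cases
    case ab
    then show ?thesis using assms all_classified_two_zeros by simp
  next
    case ac
    then show ?thesis using assms by (auto intro!: all_classified_swap23[of 0 0 b d] all_classified_two_zeros)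
  next
    case ad
    then show ?thesis using assms by (auto intro!: all_classified_swap24[of 0 0 c b] all_classified_two_zeros)
  next
    case bc
    then show ?thesis using assms by (auto intro!: all_classified_swap13[of 0 0 a d] all_classified_two_zeros)
  next
    case bd
    then show ?thesis using assms by (auto intro!: all_classified_swap14[of 0 0 c a] all_classified_two_zeros)
  next
    case cd
    then show ?thesis using assms
      by (auto intro!: all_classified_swap13[of 0 b a 0] all_classified_swap24[of 0 0 a b] all_classified_two_zeros)
  next
    case a
    then show ?thesis using assms all_classified_swap12[OF all_classified_if_one_zero] by simp
  next
    case b
    then show ?thesis using assms all_classified_if_one_zero by simp
  next
    case c
    then show ?thesis using assms all_classified_swap23[OF all_classified_if_one_zero] by simp
  next
    case d
    then show ?thesis using assms all_classified_swap24[OF all_classified_if_one_zero] by simp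
  qed
qed

section \<open>The classification\<close>

theorem theorem2p5:
  fixes lam \<gamma> \<tau> :: real and A :: ternary
  assumes "diff_operator 4 A"
    and "vect1_invariant (lam, \<gamma>, \<tau>) (lam + \<gamma> + \<tau> + 4) A"
  shows "\<exists>lam' \<gamma>' \<tau>' \<mu>' c (B :: ternary).
    up_to_perm_dual ((lam, \<gamma>, \<tau>), lam + \<gamma> + \<tau> + 4, A)
                    ((lam', \<gamma>', \<tau>'), \<mu>', \<lambda>x. smult c (B x)) \<and>
    \<mu>' = lam' + \<gamma>' + \<tau>' + 4 \<and>
    ( (\<gamma>' = 0 \<and> lam' = 0 \<and>
        (\<exists>\<epsilon>1 \<epsilon>2. \<forall>\<phi> \<psi> \<chi>. B (\<phi>, \<psi>, \<chi>) =
           smult \<epsilon>1 (poisson 3 \<tau>' (poisson 1 1 (de_rham \<phi>) (de_rham \<psi>)) \<chi>)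
         + smult \<epsilon>2 (poisson (\<tau>' + 2) 1 (poisson \<tau>' 1 \<chi> (de_rham \<phi>)) (de_rham \<psi>))))
    \<or> (lam' = -2 \<and> \<gamma>' = 0 \<and> \<tau>' = -2 \<and>
        (\<exists>\<epsilon>1 \<epsilon>2. \<forall>\<phi> \<psi> \<chi>. B (\<phi>, \<psi>, \<chi>) =
           smult \<epsilon>1 (poisson 1 (-2) (de_rham (poisson 1 (-2) (de_rham \<psi>) \<phi>)) \<chi>)
         + smult \<epsilon>2 (poisson 1 (-2) (de_rham (poisson 1 (-2) (de_rham \<psi>) \<chi>)) \<phi>)))
    \<or> (\<gamma>' = 0 \<and> lam' \<noteq> 0 \<and> \<tau>' \<noteq> 0 \<and>
        (\<forall>\<phi> \<psi> \<chi>. B (\<phi>, \<psi>, \<chi>) = Delta3 lam' 1 \<tau>' (\<phi>, de_rham \<psi>, \<chi>)))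
    \<or> (lam' = -2/3 \<and> \<gamma>' = -2/3 \<and> \<tau>' \<noteq> -1 \<and>
        (\<forall>\<phi> \<psi> \<chi>. B (\<phi>, \<psi>, \<chi>) = poisson (5/3) \<tau>' (grozman \<phi> \<psi>) \<chi>))
    \<or> (lam' = -1 \<and> \<gamma>' = -2/3 \<and> \<tau>' = -2/3 \<and>
        (\<exists>\<epsilon>1 \<epsilon>2. \<forall>\<phi> \<psi> \<chi>. B (\<phi>, \<psi>, \<chi>) =
           smult \<epsilon>1 (grozman (poisson (-1) (-2/3) \<phi> \<psi>) \<chi>)
         + smult \<epsilon>2 (grozman (poisson (-1) (-2/3) \<phi> \<chi>) \<psi>)))
    \<or> (lam' = -3/2 - \<tau>' \<and> \<gamma>' = \<tau>' \<and> \<tau>' \<notin> {-3/2, -2/3, 0, -3/4} \<and>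
        (\<forall>\<phi> \<psi> \<chi>. B (\<phi>, \<psi>, \<chi>) = Xi \<tau>' (\<phi>, \<psi>, \<chi>)))
    \<or> (lam' = -3/4 \<and> \<gamma>' = -3/4 \<and> \<tau>' = -3/4 \<and>
        (\<exists>s t. \<forall>\<phi> \<psi> \<chi>. B (\<phi>, \<psi>, \<chi>) = Xi_st s t (\<phi>, \<psi>, \<chi>))))"
proof -
  obtain \<beta> i j l where A: "A = moment_op \<beta>" and eqs: "invariance_eqs lam \<gamma> \<tau> \<beta>"
    and \<beta>: "i + j + l = 4" "\<beta> i j l \<noteq> 0"
    using invariant_imp_moment_op[OF assms] by blast
  define d where "d = -3 - lam - \<gamma> - \<tau>"
  have "all_classified lam \<gamma> \<tau> d"
  proof (cases "lam = 0 \<or> \<gamma> = 0 \<or> \<tau> = 0 \<or> d = 0")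
    case True
    then show ?thesis by (intro all_classified_if_zero) (simp_all add: d_def)
  next
    case False
    then show ?thesis
      using weights_without_zero[OF eqs d_def _ _ _ _ \<beta>]
      by (intro all_classified_without_zero) (simp_all add: d_def)
  qed
  then have "classified (lam, \<gamma>, \<tau>) (lam + \<gamma> + \<tau> + 4) A"
    using eqs unfolding all_classified_def A by blast
  then show ?thesis
    unfolding classified_def canonical_def .
qed

end
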